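(* If a property $\Pi\subseteq\Sigma^n$ admits a MAP with query complexity $q$, proof length $m$ and proximity parameter $\varepsilon/2=\Omega(1)$, then it admits a sample-based $\varepsilon$-tester with sample complexity $m\cdot n^{1-1/O(q^2\log^2 q)}$.
   Context: A Merlin–Arthur proof of proximity (MAP) for $\Pi$ with proximity parameter $\varepsilon'$, proof length $m$ and query complexity $q$ is a randomised algorithm that receives explicitly a proof string $\pi\in\Sigma^m$ and has query access to $x\in\Sigma^n$, makes at most $q$ (possibly adaptive) queries to $x$, and satisfies: if $x\in\Pi$ there exists $\pi$ such that it accepts with probability at least $2/3$; if $x$ is $\varepsilon'$-far from $\Pi$ (relative Hamming distance greater than $\varepsilon'$ from every element of $\Pi$), then for every $\pi$ it rejects with probability at least $2/3$. An $\varepsilon$-tester accepts elements of $\Pi$ and rejects inputs $\varepsilon$-far from $\Pi$, each with probability at least $2/3$. A sample-based tester queries each coordinate independently with some fixed probability (possibly capping the number of samples); its sample complexity is the number of coordinates sampled. *)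

theory Defs
  imports "HOL-Probability.Probability" "HOL-Probability.Product_PMF"
begin

text \<open>Strings in \<open>\<Sigma>^n\<close> are lists of length \<open>n\<close> over the alphabet type; positions are \<open>0, \<dots>, n - 1\<close>.\<close>

definition words :: "nat \<Rightarrow> 'a list set" where
  "words n = {x. length x = n}"

definition rel_hamming :: "'a list \<Rightarrow> 'a list \<Rightarrow> real" where
  "rel_hamming x y = real (card {i. i < length x \<and> x ! i \<noteq> y ! i}) / real (length x)"

definition far :: "real \<Rightarrow> 'a list set \<Rightarrow> 'a list \<Rightarrow> bool" where
  "far \<epsilon> P x \<longleftrightarrow> (\<forall>y\<in>P. rel_hamming x y > \<epsilon>)"

text \<open>A deterministic adaptive query algorithm is a decision tree. \<open>Query i k\<close> reads position
  \<open>i\<close> of the input and continues with \<open>k a\<close> where \<open>a\<close> is the symbol read. A randomised algorithm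
  is a probability distribution over decision trees.\<close>

datatype 'a dtree = Verdict bool | Query nat "'a \<Rightarrow> 'a dtree"

primrec verdict :: "'a dtree \<Rightarrow> 'a list \<Rightarrow> bool" where
  "verdict (Verdict b) x = b"
| "verdict (Query i k) x = verdict (k (x ! i)) x"

primrec queries :: "'a dtree \<Rightarrow> 'a list \<Rightarrow> nat list" where
  "queries (Verdict b) x = []"
| "queries (Query i k) x = i # queries (k (x ! i)) x"

definition rand_output :: "'a dtree pmf \<Rightarrow> 'a list \<Rightarrow> bool pmf" where
  "rand_output M x = map_pmf (\<lambda>t. verdict t x) M"

definition query_bounded :: "nat \<Rightarrow> nat \<Rightarrow> 'a dtree pmf \<Rightarrow> bool" where
  "query_bounded n q M \<longleftrightarrow>
    (\<forall>t\<in>set_pmf M. \<forall>x\<in>words n. set (queries t x) \<subseteq> {..<n} \<and> length (queries t x) \<le> q)"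

text \<open>The verifier \<open>V\<close> receives the whole proof \<open>\<pi>\<close> for free: its query algorithm \<open>V \<pi>\<close> may depend
  on \<open>\<pi>\<close> arbitrarily.\<close>

definition is_MAP :: "nat \<Rightarrow> nat \<Rightarrow> nat \<Rightarrow> real \<Rightarrow> 'a list set \<Rightarrow> ('a list \<Rightarrow> 'a dtree pmf) \<Rightarrow> bool" where
  "is_MAP n m q \<epsilon> P V \<longleftrightarrow>
    (\<forall>\<pi>\<in>words m. query_bounded n q (V \<pi>)) \<and>
    (\<forall>x\<in>P. \<exists>\<pi>\<in>words m. pmf (rand_output (V \<pi>) x) True \<ge> 2 / 3) \<and>
    (\<forall>x\<in>words n. far \<epsilon> P x \<longrightarrow> (\<forall>\<pi>\<in>words m. pmf (rand_output (V \<pi>) x) False \<ge> 2 / 3))"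

definition admits_MAP :: "nat \<Rightarrow> nat \<Rightarrow> nat \<Rightarrow> real \<Rightarrow> 'a list set \<Rightarrow> bool" where
  "admits_MAP n m q \<epsilon> P \<longleftrightarrow> (\<exists>V. is_MAP n m q \<epsilon> P V)"

text \<open>Here an algorithm is given by its output distribution on each input.\<close>

definition is_tester :: "nat \<Rightarrow> real \<Rightarrow> 'a list set \<Rightarrow> ('a list \<Rightarrow> bool pmf) \<Rightarrow> bool" where
  "is_tester n \<epsilon> P A \<longleftrightarrow>
    (\<forall>x\<in>P. pmf (A x) True \<ge> 2 / 3) \<and>
    (\<forall>x\<in>words n. far \<epsilon> P x \<longrightarrow> pmf (A x) False \<ge> 2 / 3)"

definition random_subset :: "nat \<Rightarrow> real \<Rightarrow> nat set pmf" where
  "random_subset n p =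
    map_pmf (\<lambda>f. {i. i < n \<and> f i}) (Pi_pmf {..<n} False (\<lambda>_. bernoulli_pmf p))"

definition view :: "'a list \<Rightarrow> nat set \<Rightarrow> nat \<Rightarrow> 'a option" where
  "view x Q = (\<lambda>i. if i \<in> Q then Some (x ! i) else None)"

text \<open>The sample-based algorithm with sampling probability \<open>p\<close>, cap \<open>s\<close> and randomised decision
  rule \<open>D\<close>: if the drawn set exceeds the cap, no coordinate of the input is read at all, so at most
  \<open>s\<close> coordinates are ever read. The rule \<open>D\<close> sees the drawn set and the symbols read.\<close>

definition capped :: "nat \<Rightarrow> nat set \<Rightarrow> nat set" where
  "capped s S = (if card S \<le> s then S else {})"

definition sample_based ::
    "nat \<Rightarrow> real \<Rightarrow> nat \<Rightarrow> (nat set \<Rightarrow> (nat \<Rightarrow> 'a option) \<Rightarrow> bool pmf) \<Rightarrow> 'a list \<Rightarrow> bool pmf" where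
  "sample_based n p s D x = bind_pmf (random_subset n p) (\<lambda>S. D S (view x (capped s S)))"

definition admits_sample_based_tester :: "nat \<Rightarrow> nat \<Rightarrow> real \<Rightarrow> 'a list set \<Rightarrow> bool" where
  "admits_sample_based_tester n s \<epsilon> P \<longleftrightarrow>
    (\<exists>p D. 0 \<le> p \<and> p \<le> 1 \<and> is_tester n \<epsilon> P (sample_based n p s D))"

end

theory Submission
  imports Defs
begin

text \<open>Let a verifier, amplified by majority vote to error \<open>\<delta> \<approx> 1/q\<close>, make \<open>q\<close> queries. Give a coordinate the
  probability that the verifier can query it on some input as its degree, and cut the degrees into
  \<open>q + 1\<close> layers by geometrically growing thresholds. On every input each run of the verifier queries
  at most \<open>q\<close> coordinates, hence misses a layer; so on a word of the property some layer is missed and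
  the word accepted with probability at least \<open>1/(q + 1) - \<delta>\<close>. Fix such a layer, call the coordinates above
  it the kernel, and the queries below it a petal. The tester guesses the proof, the layer and the
  symbols on the kernel, and estimates the acceptance probability from the petals that lie inside the
  sample, weighting a petal \<open>B\<close> by \<open>p\<close> to the power \<open>-|B|\<close>. The kernel is so small that a wrong guess turns
  a word \<open>\<epsilon>\<close>-far from the property into one that is still \<open>\<epsilon>/2\<close>-far and hence rejected.

  The \<open>k\<close>-th moment of the estimator is at most \<open>(\<mu> + k q d / p^q)^k\<close>, where \<open>d\<close> bounds the degrees
  of petal coordinates: \<open>k\<close> independent petals are correlated only where they intersect. So the error is
  \<open>2^(-k)\<close> with \<open>k \<approx> \<delta> p^q / (q d)\<close>. This beats the number of guesses because the kernel has size
  inversely proportional to the upper threshold of the layer, which exceeds \<open>d\<close> by a factor \<open>n^(1/(q + 2))\<close>.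

  If \<open>m n^(1 - 1/(C q^2 ln^2 q))\<close> is at least \<open>(1 - \<epsilon>0) n\<close>, reading almost the whole input suffices; this
  is why \<open>q\<close> may be assumed to be of order at most \<open>sqrt (ln n)\<close> and \<open>m\<close> to be tiny.\<close>

subsection \<open>Moments of the petal estimator\<close>

lemma finite_set_random_subset: "finite (set_pmf (random_subset n p))"
  unfolding random_subset_def
  by (rule finite_subset[of _ "Pow {..<n}"]) auto

lemma set_random_subset: "S \<in> set_pmf (random_subset n p) \<Longrightarrow> S \<subseteq> {..<n}"
  unfolding random_subset_def by auto

lemma prob_random_subset_superset:
  assumes "0 \<le> p" "p \<le> 1" "U \<subseteq> {..<n}"
  shows "measure_pmf.prob (random_subset n p) {S. U \<subseteq> S} = p ^ card U"
proof -
  have "(\<lambda>f. {i. i < n \<and> f i}) -` {S. U \<subseteq> S} = Pi {..<n} (\<lambda>i. if i \<in> U then {True} else UNIV)"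
    using assms(3) by (fastforce simp: Pi_def subset_iff)
  then have "measure_pmf.prob (random_subset n p) {S. U \<subseteq> S}
      = (\<Prod>i<n. measure_pmf.prob (bernoulli_pmf p) (if i \<in> U then {True} else UNIV))"
    unfolding random_subset_def by (simp add: measure_map_pmf measure_Pi_pmf_Pi)
  also have "\<dots> = (\<Prod>i<n. if i \<in> U then p else 1)"
    using assms by (intro prod.cong) (auto simp: measure_pmf_single)
  also have "\<dots> = (\<Prod>i\<in>U. p)"
    using assms(3) by (simp add: prod.If_cases Int_absorb1)
  finally show ?thesis by simp
qed

lemma expectation_swap:
  fixes f :: "'a \<Rightarrow> 'b \<Rightarrow> real"
  assumes "finite (set_pmf M)" "finite (set_pmf N)"
  shows "measure_pmf.expectation M (\<lambda>x. measure_pmf.expectation N (f x))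
    = measure_pmf.expectation N (\<lambda>y. measure_pmf.expectation M (\<lambda>x. f x y))"
proof -
  have "measure_pmf.expectation M (\<lambda>x. measure_pmf.expectation N (f x))
      = (\<Sum>x\<in>set_pmf M. \<Sum>y\<in>set_pmf N. f x y * pmf N y * pmf M x)"
    using assms by (simp add: integral_measure_pmf_real[OF assms(1)] integral_measure_pmf_real[OF assms(2)] sum_distrib_right)
  also have "\<dots> = (\<Sum>y\<in>set_pmf N. \<Sum>x\<in>set_pmf M. f x y * pmf M x * pmf N y)"
    by (subst sum.swap) (simp add: mult_ac)
  also have "\<dots> = measure_pmf.expectation N (\<lambda>y. measure_pmf.expectation M (\<lambda>x. f x y))"
    using assms by (simp add: integral_measure_pmf_real[OF assms(1)] integral_measure_pmf_real[OF assms(2)] sum_distrib_right)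
  finally show ?thesis .
qed

lemma expectation_mono:
  fixes f g :: "'a \<Rightarrow> real"
  assumes "finite (set_pmf M)" "\<And>x. x \<in> set_pmf M \<Longrightarrow> f x \<le> g x"
  shows "measure_pmf.expectation M f \<le> measure_pmf.expectation M g"
  using assms by (intro integral_mono_AE integrable_measure_pmf_finite) (auto simp: AE_measure_pmf_iff)

lemma expectation_cong:
  fixes f g :: "'a \<Rightarrow> real"
  assumes "\<And>x. x \<in> set_pmf M \<Longrightarrow> f x = g x"
  shows "measure_pmf.expectation M f = measure_pmf.expectation M g"
  using assms by (intro integral_cong_AE) (auto simp: AE_measure_pmf_iff)

lemma expectation_of_bool:
  "measure_pmf.expectation M (\<lambda>x. of_bool (Q x)) = measure_pmf.prob M {x. Q x}"
proof -
  have "(\<lambda>x. of_bool (Q x)) = indicat_real {x. Q x}" by (auto simp: fun_eq_iff)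
  then show ?thesis by simp
qed

lemma prob_mono:
  assumes "\<And>x. x \<in> set_pmf M \<Longrightarrow> x \<in> A \<Longrightarrow> x \<in> B"
  shows "measure_pmf.prob M A \<le> measure_pmf.prob M B"
proof -
  have "measure_pmf.prob M A = measure_pmf.prob M (A \<inter> set_pmf M)"
    by (simp add: measure_Int_set_pmf)
  also have "\<dots> \<le> measure_pmf.prob M B"
    using assms by (intro measure_pmf.finite_measure_mono) auto
  finally show ?thesis .
qed

text \<open>Inverse-probability weighting: a petal inside \<open>{..<n}\<close> lies in the sample
  with probability \<open>p ^ card (B t)\<close>, so \<open>t\<close> contributes \<open>a t\<close>
  on average and the estimator is unbiased. An empty petal counts whatever the sample is.\<close>

definition petal_estimator ::
    "'w pmf \<Rightarrow> ('w \<Rightarrow> real) \<Rightarrow> ('w \<Rightarrow> nat set) \<Rightarrow> real \<Rightarrow> nat set \<Rightarrow> real" where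
  "petal_estimator M a B p S =
    measure_pmf.expectation M (\<lambda>t. a t * of_bool (B t \<subseteq> S) / p ^ card (B t))"

text \<open>The bound \<open>d\<close> on how often a coordinate occurs in a petal controls all
  correlations. The locale serves twice: with singletons it gives concentration of the sample size,
  with the queries below a layer it gives the estimate of the tester.\<close>

locale petals =
  fixes M :: "'w pmf" and a :: "'w \<Rightarrow> real" and B :: "'w \<Rightarrow> nat set" and n q :: nat and d p :: real
  assumes fin: "finite (set_pmf M)"
    and a01: "\<And>t. t \<in> set_pmf M \<Longrightarrow> 0 \<le> a t \<and> a t \<le> 1"
    and B: "\<And>t. t \<in> set_pmf M \<Longrightarrow> B t \<subseteq> {..<n} \<and> card (B t) \<le> q"
    and deg: "\<And>v. v < n \<Longrightarrow> measure_pmf.prob M {t. v \<in> B t} \<le> d"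
    and p: "0 < p" "p \<le> 1" and d0: "0 \<le> d"
begin

abbreviation \<mu> :: real where "\<mu> \<equiv> measure_pmf.expectation M a"

abbreviation X :: "nat set \<Rightarrow> real" where "X \<equiv> petal_estimator M a B p"

lemma mu_bounds: "0 \<le> \<mu>" "\<mu> \<le> 1"
proof -
  show "0 \<le> \<mu>" using a01 by (intro integral_nonneg_AE) (auto simp: AE_measure_pmf_iff)
  have "\<mu> \<le> measure_pmf.expectation M (\<lambda>_. 1)" using a01 by (intro expectation_mono fin) auto
  then show "\<mu> \<le> 1" by simp
qed

lemma X_nonneg: "0 \<le> X S"
  unfolding petal_estimator_def using a01 p
  by (intro integral_nonneg_AE) (auto simp: AE_measure_pmf_iff)

text \<open>A petal that avoids \<open>U\<close> contributes just \<open>a t\<close>. One that meets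
  \<open>U\<close> contributes at most \<open>1 / p ^ q\<close>, and by a union bound over
  \<open>U\<close> this happens with probability at most \<open>card U * d\<close>.\<close>

lemma expectation_collision:
  assumes "U \<subseteq> {..<n}"
  shows "measure_pmf.expectation M (\<lambda>t. a t / p ^ card (U \<inter> B t)) \<le> \<mu> + card U * d / p ^ q"
proof -
  have finU: "finite U" using assms finite_subset by blast
  have "measure_pmf.expectation M (\<lambda>t. a t / p ^ card (U \<inter> B t))
      \<le> measure_pmf.expectation M (\<lambda>t. a t + of_bool (U \<inter> B t \<noteq> {}) / p ^ q)"
  proof (intro expectation_mono fin)
    fix t assume t: "t \<in> set_pmf M"
    show "a t / p ^ card (U \<inter> B t) \<le> a t + of_bool (U \<inter> B t \<noteq> {}) / p ^ q"
    proof (cases "U \<inter> B t = {}")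
      case False
      have "card (U \<inter> B t) \<le> card (B t)"
        using B[OF t] by (intro card_mono) (auto intro: finite_subset)
      then have "p ^ q \<le> p ^ card (U \<inter> B t)"
        using p B[OF t] by (intro power_decreasing) auto
      then have "a t / p ^ card (U \<inter> B t) \<le> 1 / p ^ q"
        using p a01[OF t] by (intro frac_le) auto
      then show ?thesis using False a01[OF t] by simp
    qed simp
  qed
  also have "\<dots> = \<mu> + measure_pmf.prob M {t. U \<inter> B t \<noteq> {}} / p ^ q"
    by (simp add: Bochner_Integration.integral_add integrable_measure_pmf_finite fin expectation_of_bool
        del: of_bool_not_iff)
  also have "measure_pmf.prob M {t. U \<inter> B t \<noteq> {}} \<le> (\<Sum>v\<in>U. measure_pmf.prob M {t. v \<in> B t})"
  proof -
    have "{t. U \<inter> B t \<noteq> {}} = (\<Union>v\<in>U. {t. v \<in> B t})" by auto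
    then show ?thesis using finU by (simp add: measure_pmf.finite_measure_subadditive_finite)
  qed
  also have "\<dots> \<le> (\<Sum>v\<in>U. d)" using assms deg by (intro sum_mono) auto
  finally show ?thesis using p by (simp add: divide_right_mono)
qed

text \<open>Expanding one factor of \<open>X S ^ Suc k\<close> as an average over \<open>t\<close> replaces the set \<open>U\<close> by \<open>U \<union> B t\<close>.\<close>

lemma moment_bound:
  assumes "U \<subseteq> {..<n}"
  shows "measure_pmf.expectation (random_subset n p) (\<lambda>S. X S ^ k * of_bool (U \<subseteq> S))
    \<le> p ^ card U * (\<Prod>i<k. \<mu> + (card U + i * q) * d / p ^ q)"
  using assms
proof (induction k arbitrary: U)
  case 0
  then show ?case using p by (simp add: expectation_of_bool prob_random_subset_superset)
next
  case (Suc k)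
  let ?R = "random_subset n p"
  let ?G = "\<Prod>i<k. \<mu> + (card U + Suc i * q) * d / p ^ q"
  have finU: "finite U" using Suc.prems finite_subset by blast
  have pos: "0 \<le> \<mu> + real j * d / p ^ q" for j
    using mu_bounds d0 p by auto
  have "measure_pmf.expectation ?R (\<lambda>S. X S ^ Suc k * of_bool (U \<subseteq> S))
    = measure_pmf.expectation ?R (\<lambda>S. measure_pmf.expectation M (\<lambda>t.
        a t / p ^ card (B t) * (X S ^ k * of_bool (U \<union> B t \<subseteq> S))))"
  proof (intro expectation_cong)
    fix S
    have "X S ^ Suc k * of_bool (U \<subseteq> S) = X S ^ k * of_bool (U \<subseteq> S) *
        measure_pmf.expectation M (\<lambda>t. a t * of_bool (B t \<subseteq> S) / p ^ card (B t))"
      by (simp add: petal_estimator_def)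
    also have "\<dots> = measure_pmf.expectation M (\<lambda>t. X S ^ k * of_bool (U \<subseteq> S) *
        (a t * of_bool (B t \<subseteq> S) / p ^ card (B t)))"
      by (simp only: integral_mult_right_zero)
    also have "\<dots> = measure_pmf.expectation M (\<lambda>t.
        a t / p ^ card (B t) * (X S ^ k * of_bool (U \<union> B t \<subseteq> S)))"
      by (intro expectation_cong) auto
    finally show "X S ^ Suc k * of_bool (U \<subseteq> S) = \<dots>" .
  qed
  also have "\<dots> = measure_pmf.expectation M (\<lambda>t. measure_pmf.expectation ?R (\<lambda>S.
        a t / p ^ card (B t) * (X S ^ k * of_bool (U \<union> B t \<subseteq> S))))"
    by (rule expectation_swap[OF finite_set_random_subset fin])
  also have "\<dots> = measure_pmf.expectation M (\<lambda>t. a t / p ^ card (B t) *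
       measure_pmf.expectation ?R (\<lambda>S. X S ^ k * of_bool (U \<union> B t \<subseteq> S)))"
    by (simp only: integral_mult_right_zero)
  also have "\<dots> \<le> measure_pmf.expectation M (\<lambda>t. a t / p ^ card (U \<inter> B t) * (p ^ card U * ?G))"
  proof (intro expectation_mono fin)
    fix t assume t: "t \<in> set_pmf M"
    have Ub: "U \<union> B t \<subseteq> {..<n}" using B[OF t] Suc.prems by auto
    have finB: "finite (B t)" using B[OF t] finite_subset by blast
    have "a t / p ^ card (B t) * measure_pmf.expectation ?R (\<lambda>S. X S ^ k * of_bool (U \<union> B t \<subseteq> S))
      \<le> a t / p ^ card (B t) * (p ^ card (U \<union> B t) * (\<Prod>i<k. \<mu> + (card (U \<union> B t) + i * q) * d / p ^ q))"
      using a01[OF t] p by (intro mult_left_mono Suc.IH[OF Ub]) auto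
    \<comment> \<open>\<open>U \<union> B t\<close> has at most \<open>q\<close> more elements than
      \<open>U\<close>, so its factor of index \<open>i\<close> is bounded by the factor of index
      \<open>Suc i\<close> for \<open>U\<close>. The factor of index 0 is left for the collision
      term.\<close>
    also have "\<dots> \<le> a t / p ^ card (B t) * (p ^ card (U \<union> B t) * ?G)"
    proof (intro mult_left_mono prod_mono conjI)
      fix i
      have c: "card (U \<union> B t) + i * q \<le> card U + Suc i * q"
        using card_Un_le[of U "B t"] B[OF t] by simp
      show "0 \<le> \<mu> + real (card (U \<union> B t) + i * q) * d / p ^ q" by (rule pos)
      show "\<mu> + real (card (U \<union> B t) + i * q) * d / p ^ q \<le> \<mu> + real (card U + Suc i * q) * d / p ^ q"
        using c d0 p by (intro add_left_mono divide_right_mono mult_right_mono) (linarith | simp)+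
    qed (use a01[OF t] p in auto)
    also have "\<dots> = a t * (p ^ card (U \<union> B t) / p ^ card (B t)) * ?G" by simp
    \<comment> \<open>Only coordinates of \<open>B t\<close> outside \<open>U\<close> cost a new
      power of \<open>p\<close>; the surplus weight is \<open>1 / p ^ card (U \<inter> B t)\<close>,
      which \<open>expectation_collision\<close> averages.\<close>
    also have "p ^ card (U \<union> B t) / p ^ card (B t) = p ^ card U / p ^ card (U \<inter> B t)"
      using card_Un_Int[OF finU finB] p by (simp add: field_simps flip: power_add)
    also have "a t * (p ^ card U / p ^ card (U \<inter> B t)) * ?G = a t / p ^ card (U \<inter> B t) * (p ^ card U * ?G)"
      by simp
    finally show "a t / p ^ card (B t) * measure_pmf.expectation ?R (\<lambda>S. X S ^ k * of_bool (U \<union> B t \<subseteq> S))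
       \<le> a t / p ^ card (U \<inter> B t) * (p ^ card U * ?G)" .
  qed
  also have "\<dots> = measure_pmf.expectation M (\<lambda>t. a t / p ^ card (U \<inter> B t)) * (p ^ card U * ?G)"
    by (simp only: integral_mult_left_zero)
  also have "\<dots> \<le> (\<mu> + card U * d / p ^ q) * (p ^ card U * ?G)"
    using p by (intro mult_right_mono expectation_collision Suc.prems mult_nonneg_nonneg prod_nonneg ballI pos) auto
  also have "\<dots> = p ^ card U * (\<Prod>i<Suc k. \<mu> + (card U + i * q) * d / p ^ q)"
    by (subst prod.lessThan_Suc_shift) simp
  finally show ?case .
qed

lemma expectation_X: "measure_pmf.expectation (random_subset n p) X = \<mu>"
proof -
  have "measure_pmf.expectation (random_subset n p) X = measure_pmf.expectation M (\<lambda>t.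
      measure_pmf.expectation (random_subset n p) (\<lambda>S. a t / p ^ card (B t) * of_bool (B t \<subseteq> S)))"
    unfolding petal_estimator_def
    by (subst expectation_swap[OF finite_set_random_subset fin]) simp
  also have "\<dots> = measure_pmf.expectation M (\<lambda>t. a t / p ^ card (B t) * p ^ card (B t))"
    using B p by (intro expectation_cong)
      (simp only: integral_mult_right_zero expectation_of_bool prob_random_subset_superset less_imp_le)
  finally show ?thesis using p by simp
qed

text \<open>The hypotheses bound every factor of the \<open>k\<close>-th moment by
  \<open>2 * \<delta>\<close>; Markov's inequality for the \<open>k\<close>-th power at
  \<open>4 * \<delta>\<close> gains a factor 2 per moment.\<close>

lemma upper_tail:
  assumes "\<mu> \<le> \<delta>" "0 < \<delta>" "real k * q * d / p ^ q \<le> \<delta>"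
  shows "measure_pmf.prob (random_subset n p) {S. 4 * \<delta> \<le> X S} \<le> (1 / 2) ^ k"
proof -
  let ?R = "random_subset n p"
  have "measure_pmf.expectation ?R (\<lambda>S. X S ^ k) \<le> (\<Prod>i<k. \<mu> + (real (i * q)) * d / p ^ q)"
    using moment_bound[of "{}" k] by simp
  also have "\<dots> \<le> (\<Prod>i<k. 2 * \<delta>)"
  proof (intro prod_mono conjI)
    fix i assume i: "i \<in> {..<k}"
    show "0 \<le> \<mu> + real (i * q) * d / p ^ q" using mu_bounds d0 p by simp
    have "real (i * q) * d / p ^ q \<le> real (k * q) * d / p ^ q"
      using i d0 p by (intro divide_right_mono mult_right_mono of_nat_mono mult_le_mono1) auto
    then show "\<mu> + real (i * q) * d / p ^ q \<le> 2 * \<delta>" using assms by simp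
  qed
  finally have m: "measure_pmf.expectation ?R (\<lambda>S. X S ^ k) \<le> (2 * \<delta>) ^ k" by simp
  have "measure_pmf.prob ?R {S. 4 * \<delta> \<le> X S} \<le> measure_pmf.prob ?R {S. (4 * \<delta>) ^ k \<le> X S ^ k}"
    using assms by (intro prob_mono CollectI power_mono) auto
  also have "\<dots> \<le> measure_pmf.expectation ?R (\<lambda>S. X S ^ k) / (4 * \<delta>) ^ k"
    using integral_Markov_inequality_measure[of ?R "\<lambda>S. X S ^ k" "{}" "(4 * \<delta>) ^ k"] assms X_nonneg
    by (simp add: integrable_measure_pmf_finite finite_set_random_subset)
  also have "\<dots> \<le> (2 * \<delta>) ^ k / (4 * \<delta>) ^ k"
    using m assms by (intro divide_right_mono) auto
  also have "\<dots> = (1 / 2) ^ k"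
    using assms by (simp flip: power_divide)
  finally show ?thesis .
qed

text \<open>Chebyshev's inequality: the second moment exceeds \<open>\<mu>\<^sup>2\<close> by at
  most \<open>\<mu> * q * d / p ^ q\<close>, and \<open>\<mu> \<le> 1\<close>.\<close>

lemma deviation:
  assumes "0 < c"
  shows "measure_pmf.prob (random_subset n p) {S. c \<le> \<bar>X S - \<mu>\<bar>} \<le> q * d / p ^ q / c\<^sup>2"
proof -
  let ?R = "random_subset n p"
  note [simp] = integrable_measure_pmf_finite[OF finite_set_random_subset]
  have "measure_pmf.expectation ?R (\<lambda>S. (X S)\<^sup>2) \<le> \<mu> * (\<mu> + q * d / p ^ q)"
    using moment_bound[of "{}" 2] by (simp add: numeral_2_eq_2)
  moreover have "measure_pmf.expectation ?R (\<lambda>S. (X S - \<mu>)\<^sup>2)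
      = measure_pmf.expectation ?R (\<lambda>S. (X S)\<^sup>2) - \<mu>\<^sup>2"
  proof -
    have "measure_pmf.expectation ?R (\<lambda>S. (X S - \<mu>)\<^sup>2)
        = measure_pmf.expectation ?R (\<lambda>S. (X S)\<^sup>2 - 2 * \<mu> * X S + \<mu>\<^sup>2)"
      by (simp add: power2_diff mult_ac)
    also have "\<dots> = measure_pmf.expectation ?R (\<lambda>S. (X S)\<^sup>2) - 2 * \<mu> * \<mu> + \<mu>\<^sup>2"
      by (subst expectation_X[symmetric]) simp
    finally show ?thesis by (simp add: power2_eq_square)
  qed
  moreover have "\<mu> * (q * d / p ^ q) \<le> 1 * (q * d / p ^ q)"
    using mu_bounds d0 p by (intro mult_right_mono) auto
  ultimately have "measure_pmf.expectation ?R (\<lambda>S. (X S - \<mu>)\<^sup>2) \<le> q * d / p ^ q"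
    unfolding distrib_left power2_eq_square[of \<mu>] by linarith
  moreover have "measure_pmf.prob ?R {S. c \<le> \<bar>X S - \<mu>\<bar>}
      \<le> measure_pmf.expectation ?R (\<lambda>S. (X S - \<mu>)\<^sup>2) / c\<^sup>2"
    using measure_pmf.second_moment_method[of "\<lambda>S. X S - \<mu>" ?R c] assms by simp
  ultimately show ?thesis
    using assms by (smt (verit) divide_right_mono zero_le_power2)
qed

end

text \<open>The petal of a uniform coordinate is its singleton, so the estimator is
  \<open>card S / (p * n)\<close> with mean 1, and \<open>q = 1\<close>,
  \<open>d = 1 / n\<close>.\<close>

lemma card_random_subset_deviation:
  assumes "0 < n" "0 < p" "p \<le> 1" "0 < c"
  shows "measure_pmf.prob (random_subset n p) {S. c * (p * n) \<le> \<bar>real (card S) - p * n\<bar>} \<le> 1 / (p * n * c\<^sup>2)"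
proof -
  let ?M = "pmf_of_set {..<n}"
  have ne: "{..<n} \<noteq> {}" using assms by auto
  interpret petals ?M "\<lambda>_. 1" "\<lambda>v. {v}" n 1 "1 / n" p
    using assms ne by unfold_locales (auto simp: set_pmf_of_set measure_pmf_of_set)
  have X: "petal_estimator ?M (\<lambda>_. 1) (\<lambda>v. {v}) p S = real (card S) / (p * n)" if "S \<subseteq> {..<n}" for S
  proof -
    have "petal_estimator ?M (\<lambda>_. 1) (\<lambda>v. {v}) p S = (\<Sum>v<n. of_bool (v \<in> S) / p) / n"
      unfolding petal_estimator_def using ne by (subst integral_pmf_of_set) auto
    also have "(\<Sum>v<n. of_bool (v \<in> S) / p) = card S / p"
      unfolding sum_divide_distrib[symmetric] using that by (simp add: Int_absorb1)
    finally show ?thesis by simp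
  qed
  have "measure_pmf.prob (random_subset n p) {S. c * (p * n) \<le> \<bar>real (card S) - p * n\<bar>}
      \<le> measure_pmf.prob (random_subset n p) {S. c \<le> \<bar>X S - \<mu>\<bar>}"
  proof (intro prob_mono)
    fix S assume S: "S \<in> set_pmf (random_subset n p)" "S \<in> {S. c * (p * n) \<le> \<bar>real (card S) - p * n\<bar>}"
    have "real (card S) - p * n = (X S - \<mu>) * (p * n)"
      using assms X[OF set_random_subset[OF S(1)]] by (simp add: field_simps)
    then show "S \<in> {S. c \<le> \<bar>X S - \<mu>\<bar>}" using S(2) assms by (simp add: abs_mult)
  qed
  also have "\<dots> \<le> 1 / (p * n * c\<^sup>2)"
    using deviation[OF assms(4)] by (simp add: field_simps)
  finally show ?thesis .
qed

subsection \<open>Testers from local tests\<close>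

text \<open>A deterministic adaptive test, reduced to the set it queries and its verdict. The last
  clause expresses adaptivity: the symbols on the queried set determine both that set and the
  verdict.\<close>

definition local_test :: "nat \<Rightarrow> nat \<Rightarrow> ('a list \<Rightarrow> nat set \<times> bool) \<Rightarrow> bool" where
  "local_test n q g \<longleftrightarrow> (\<forall>x\<in>words n. fst (g x) \<subseteq> {..<n} \<and> card (fst (g x)) \<le> q \<and>
     (\<forall>y\<in>words n. (\<forall>i\<in>fst (g x). y ! i = x ! i) \<longrightarrow> g y = g x))"

lemma local_test_queries:
  assumes "local_test n q g" "x \<in> words n"
  shows "fst (g x) \<subseteq> {..<n}" "card (fst (g x)) \<le> q" "finite (fst (g x))"
proof -
  show "fst (g x) \<subseteq> {..<n}" "card (fst (g x)) \<le> q"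
    using assms unfolding local_test_def by blast+
  then show "finite (fst (g x))" using finite_subset by blast
qed

text \<open>Taken over all inputs, so that degrees, layers and kernels do not depend on the unknown
  input.\<close>

definition footprint :: "nat \<Rightarrow> ('a list \<Rightarrow> nat set \<times> bool) \<Rightarrow> nat set" where
  "footprint n g = (\<Union>x\<in>words n. fst (g x))"

lemma footprint_subset: "local_test n q g \<Longrightarrow> footprint n g \<subseteq> {..<n}"
  unfolding footprint_def using local_test_queries(1) by blast

text \<open>A test that meets the layer \<open>L\<close> has weight 0; its petal is set to
  \<open>{}\<close> so that no petal contains a coordinate of \<open>L\<close>, which could have too
  large a degree.\<close>

definition layer_estimate ::
    "('a list \<Rightarrow> nat set \<times> bool) pmf \<Rightarrow> nat set \<Rightarrow> nat set \<Rightarrow> real \<Rightarrow> 'a list \<Rightarrow> nat set \<Rightarrow> real" where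
  "layer_estimate M K L p z =
    petal_estimator M (\<lambda>g. of_bool (snd (g z) \<and> fst (g z) \<inter> L = {}))
      (\<lambda>g. if fst (g z) \<inter> L = {} then fst (g z) - K else {}) p"

text \<open>If the queries outside \<open>K\<close> lie in \<open>S\<close> for one of the two
  words, all its queries lie where the words agree, so the test behaves identically on both.\<close>

lemma layer_estimate_cong:
  assumes loc: "\<And>g. g \<in> set_pmf M \<Longrightarrow> local_test n q g"
    and z: "z \<in> words n" "z' \<in> words n"
    and eq: "\<And>i. i < n \<Longrightarrow> i \<in> K \<union> S \<Longrightarrow> z ! i = z' ! i"
  shows "layer_estimate M K L p z S = layer_estimate M K L p z' S"
  unfolding layer_estimate_def petal_estimator_def
proof (rule expectation_cong)
  fix g assume g: "g \<in> set_pmf M"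
  have same: "g z = g z'" if "fst (g z) - K \<subseteq> S \<or> fst (g z') - K \<subseteq> S"
  proof -
    have sub: "fst (g z) \<subseteq> {..<n}" "fst (g z') \<subseteq> {..<n}"
      and det: "\<forall>i\<in>fst (g z). z' ! i = z ! i \<Longrightarrow> g z' = g z" "\<forall>i\<in>fst (g z'). z ! i = z' ! i \<Longrightarrow> g z = g z'"
      using loc[OF g] z unfolding local_test_def by blast+
    from that show ?thesis
    proof
      assume "fst (g z) - K \<subseteq> S"
      then have "\<forall>i\<in>fst (g z). z' ! i = z ! i" using sub(1) eq by (metis DiffI UnI1 UnI2 lessThan_iff subsetD)
      then show ?thesis using det(1) by simp
    next
      assume "fst (g z') - K \<subseteq> S"
      then have "\<forall>i\<in>fst (g z'). z ! i = z' ! i" using sub(2) eq by (metis DiffI UnI1 UnI2 lessThan_iff subsetD)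
      then show ?thesis by (rule det(2))
    qed
  qed
  show "of_bool (snd (g z) \<and> fst (g z) \<inter> L = {}) *
      of_bool ((if fst (g z) \<inter> L = {} then fst (g z) - K else {}) \<subseteq> S) /
      p ^ card (if fst (g z) \<inter> L = {} then fst (g z) - K else {}) =
    of_bool (snd (g z') \<and> fst (g z') \<inter> L = {}) *
      of_bool ((if fst (g z') \<inter> L = {} then fst (g z') - K else {}) \<subseteq> S) /
      p ^ card (if fst (g z') \<inter> L = {} then fst (g z') - K else {})"
  proof (cases "fst (g z) - K \<subseteq> S \<or> fst (g z') - K \<subseteq> S")
    case True
    then show ?thesis by (simp only: same[OF True])
  next
    \<comment> \<open>Both terms vanish: for each word the test meets \<open>L\<close> and has
      weight 0, or its petal is not contained in \<open>S\<close>.\<close>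
    case False
    then show ?thesis by auto
  qed
qed

text \<open>Petals avoid both \<open>K\<close> and \<open>L\<close>, so it is enough to bound the
  degrees of the remaining coordinates.\<close>

lemma petals_layer:
  assumes fin: "finite (set_pmf M)"
    and loc: "\<And>g. g \<in> set_pmf M \<Longrightarrow> local_test n q g"
    and z: "z \<in> words n"
    and deg: "\<And>v. v < n \<Longrightarrow> v \<notin> K \<Longrightarrow> v \<notin> L \<Longrightarrow> measure_pmf.prob M {g. v \<in> footprint n g} \<le> d"
    and p: "0 < p" "p \<le> 1" and d: "0 \<le> d"
  shows "petals M (\<lambda>g. of_bool (snd (g z) \<and> fst (g z) \<inter> L = {}))
      (\<lambda>g. if fst (g z) \<inter> L = {} then fst (g z) - K else {}) n q d p"
proof
  fix g assume g: "g \<in> set_pmf M"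
  note l = local_test_queries[OF loc[OF g] z]
  have "card (fst (g z) - K) \<le> card (fst (g z))" using l by (intro card_mono) auto
  then show "(if fst (g z) \<inter> L = {} then fst (g z) - K else {}) \<subseteq> {..<n} \<and>
      card (if fst (g z) \<inter> L = {} then fst (g z) - K else {}) \<le> q"
    using l by auto
next
  fix v assume v: "v < n"
  show "measure_pmf.prob M {g. v \<in> (if fst (g z) \<inter> L = {} then fst (g z) - K else {})} \<le> d"
  proof (cases "v \<in> K \<or> v \<in> L")
    case True
    then have "measure_pmf.prob M {g. v \<in> (if fst (g z) \<inter> L = {} then fst (g z) - K else {})}
        \<le> measure_pmf.prob M {}"
      by (intro prob_mono) (auto split: if_splits)
    then show ?thesis using d by simp
  next
    case False
    have "measure_pmf.prob M {g. v \<in> (if fst (g z) \<inter> L = {} then fst (g z) - K else {})}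
        \<le> measure_pmf.prob M {g. v \<in> footprint n g}"
      using z by (intro prob_mono) (auto simp: footprint_def split: if_splits)
    then show ?thesis using deg[OF v] False by linarith
  qed
qed (use assms in auto)

text \<open>Pigeonhole principle: points of \<open>Q\<close> chosen in each of \<open>q + 1\<close>
  disjoint sets would be distinct.\<close>

lemma exists_missed_set:
  fixes L :: "nat \<Rightarrow> 'b set"
  assumes "finite Q" "card Q \<le> q" "\<And>i j. i \<le> q \<Longrightarrow> j \<le> q \<Longrightarrow> i \<noteq> j \<Longrightarrow> L i \<inter> L j = {}"
  shows "\<exists>j\<le>q. Q \<inter> L j = {}"
proof (rule ccontr)
  assume "\<not> ?thesis"
  then have "\<forall>j\<in>{..q}. \<exists>v. v \<in> Q \<inter> L j" by blast
  from bchoice[OF this] obtain f where f: "\<forall>j\<in>{..q}. f j \<in> Q \<inter> L j" ..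
  have "inj_on f {..q}"
  proof (rule inj_onI, rule ccontr)
    fix i j assume ij: "i \<in> {..q}" "j \<in> {..q}" "f i = f j" "i \<noteq> j"
    then have "f i \<in> L i \<inter> L j" using f by (metis IntD2 IntI)
    then show False using assms(3)[of i j] ij by auto
  qed
  then have "card {..q} \<le> card Q" using f assms(1) by (intro card_inj_on_le[of f]) auto
  then show False using assms(2) by simp
qed

text \<open>Triangle inequality: changing symbols on \<open>K\<close> alone moves a word by relative
  distance at most \<open>\<eta>\<close>.\<close>

lemma far_perturb:
  fixes \<eta> :: real
  assumes x: "x \<in> words n" and z: "z \<in> words n" and n: "0 < n"
    and far: "far \<epsilon> P x"
    and diff: "\<And>i. i < n \<Longrightarrow> i \<notin> K \<Longrightarrow> z ! i = x ! i" and K: "finite K" "real (card K) \<le> \<eta> * n"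
  shows "far (\<epsilon> - \<eta>) P z"
  unfolding far_def
proof
  fix y assume "y \<in> P"
  then have 1: "\<epsilon> * n < real (card {i. i < n \<and> x ! i \<noteq> y ! i})"
    using far x n by (auto simp: far_def rel_hamming_def words_def field_simps)
  have "card {i. i < n \<and> x ! i \<noteq> y ! i} \<le> card ({i. i < n \<and> z ! i \<noteq> y ! i} \<union> K)"
    using K diff by (intro card_mono) auto
  also have "\<dots> \<le> card {i. i < n \<and> z ! i \<noteq> y ! i} + card K" by (rule card_Un_le)
  finally have "(\<epsilon> - \<eta>) * n < real (card {i. i < n \<and> z ! i \<noteq> y ! i})"
    using 1 K by (simp add: algebra_simps)
  then show "\<epsilon> - \<eta> < rel_hamming z y"
    using z n by (auto simp: rel_hamming_def words_def field_simps)
qed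

text \<open>Double counting: the degrees sum to an expected set size, which is at most
  \<open>A\<close>.\<close>

lemma card_heavy:
  fixes n :: nat
  assumes fin: "finite (set_pmf M)"
    and A: "\<And>g. g \<in> set_pmf M \<Longrightarrow> finite (T g) \<and> card (T g) \<le> (A::real)"
  shows "real (card {v. v < n \<and> h < measure_pmf.prob M {g. v \<in> T g}}) * h \<le> A"
proof -
  let ?K = "{v. v < n \<and> h < measure_pmf.prob M {g. v \<in> T g}}"
  have finK: "finite ?K" by simp
  have "real (card ?K) * h = (\<Sum>v\<in>?K. h)" by simp
  also have "\<dots> \<le> (\<Sum>v\<in>?K. measure_pmf.prob M {g. v \<in> T g})" by (intro sum_mono) auto
  also have "\<dots> = measure_pmf.expectation M (\<lambda>g. \<Sum>v\<in>?K. of_bool (v \<in> T g))"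
    by (subst Bochner_Integration.integral_sum) (simp_all add: integrable_measure_pmf_finite[OF fin] expectation_of_bool)
  also have "\<dots> \<le> measure_pmf.expectation M (\<lambda>g. A)"
  proof (rule expectation_mono[OF fin])
    fix g assume g: "g \<in> set_pmf M"
    have "(\<Sum>v\<in>?K. of_bool (v \<in> T g)) = real (card (?K \<inter> T g))"
      by (subst sum_of_bool_eq[OF finK]) (rule finK, simp only: Collect_mem_eq)
    also have "\<dots> \<le> real (card (T g))" using A[OF g] by (intro of_nat_mono card_mono) auto
    finally show "(\<Sum>v\<in>?K. of_bool (v \<in> T g)) \<le> A" using A[OF g] by linarith
  qed
  finally show ?thesis by simp
qed

text \<open>The part of the candidate word outside the kernel and the sample is irrelevant.\<close>

definition fill :: "nat \<Rightarrow> nat set \<Rightarrow> (nat \<Rightarrow> 'a) \<Rightarrow> (nat \<Rightarrow> 'a option) \<Rightarrow> 'a list" where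
  "fill n K \<kappa> v = map (\<lambda>i. if i \<in> K then \<kappa> i else case v i of Some a \<Rightarrow> a | None \<Rightarrow> undefined) [0..<n]"

lemma fill_words [simp]: "fill n K \<kappa> v \<in> words n"
  by (simp add: fill_def words_def)

text \<open>The word that the tester builds depends on the sample. Replacing it by one that does not
  makes the moment bounds, which concern a fixed word, applicable.\<close>

lemma layer_estimate_fill_view:
  assumes "\<And>g. g \<in> set_pmf M \<Longrightarrow> local_test n q g"
  shows "layer_estimate M K L p (fill n K \<kappa> (view x S)) S = layer_estimate M K L p (fill n K \<kappa> (\<lambda>i. Some (x ! i))) S"
  by (rule layer_estimate_cong[OF assms]) (simp, simp, simp, auto simp: fill_def view_def)

lemma exists_probable_index:
  assumes "\<And>g. g \<in> set_pmf M \<Longrightarrow> \<exists>j\<le>(q::nat). Q j g"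
  shows "\<exists>j\<le>q. 1 \<le> (real q + 1) * measure_pmf.prob M {g. Q j g}"
proof (rule ccontr)
  assume neg: "\<not> ?thesis"
  have "1 = measure_pmf.prob M (\<Union>j\<le>q. {g. Q j g})"
    using assms by (intro measure_pmf.prob_eq_1[THEN iffD2, symmetric]) (auto simp: AE_measure_pmf_iff)
  also have "\<dots> \<le> (\<Sum>j\<le>q. measure_pmf.prob M {g. Q j g})"
    by (intro measure_pmf.finite_measure_subadditive_finite) auto
  also have "\<dots> < (\<Sum>j\<le>q. 1 / (real q + 1))"
    using neg by (intro sum_strict_mono) (auto simp: field_simps)
  finally show False by simp
qed

text \<open>\<open>I\<close> plays the set of proofs and \<open>D\<close> the thresholds of the
  layers. \<open>kernel\<close> limits the kernel to \<open>\<epsilon> / 2 * n\<close> coordinates,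
  \<open>k\<close> makes the moment of order \<open>k j\<close> usable in \<open>upper_tail\<close>,
  \<open>union\<close> pays for all guesses with \<open>b\<close> as the kernel size, and
  \<open>var\<close> and \<open>cap\<close> each cost completeness 1/6.\<close>

lemma tester_from_local_tests:
  fixes M :: "'i \<Rightarrow> ('a::finite list \<Rightarrow> nat set \<times> bool) pmf" and D :: "nat \<Rightarrow> real" and k :: "nat \<Rightarrow> nat"
  assumes I: "finite I"
    and fin: "\<And>i. i \<in> I \<Longrightarrow> finite (set_pmf (M i))"
    and loc: "\<And>i g. i \<in> I \<Longrightarrow> g \<in> set_pmf (M i) \<Longrightarrow> local_test n q g"
    and A: "\<And>i g. i \<in> I \<Longrightarrow> g \<in> set_pmf (M i) \<Longrightarrow> real (card (footprint n g)) \<le> A"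
    and P: "P \<subseteq> words n"
    and complete: "\<And>x. x \<in> P \<Longrightarrow> \<exists>i\<in>I. measure_pmf.prob (M i) {g. \<not> snd (g x)} \<le> \<delta>"
    and sound: "\<And>x i. x \<in> words n \<Longrightarrow> far (\<epsilon> / 2) P x \<Longrightarrow> i \<in> I \<Longrightarrow>
        measure_pmf.prob (M i) {g. snd (g x)} \<le> \<delta>"
    and n: "0 < n" and p: "0 < p" "p \<le> 1"
    and \<delta>: "0 < \<delta>" "6 * \<delta> * (real q + 1) \<le> 1"
    and D: "\<And>j. 0 < D j" "mono D"
    and kernel: "\<And>j. j \<le> q \<Longrightarrow> A \<le> \<epsilon> / 2 * n * D (Suc j)"
    and k: "\<And>j. j \<le> q \<Longrightarrow> real (k j) * q * D j / p ^ q \<le> \<delta>"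
    and union: "\<And>j b. j \<le> q \<Longrightarrow> real b * D (Suc j) \<le> A \<Longrightarrow>
        3 * (real q + 1) * card I * real CARD('a) ^ b \<le> 2 ^ k j"
    and var: "\<And>j. j \<le> q \<Longrightarrow> q * D j / p ^ q / \<delta>\<^sup>2 \<le> 1 / 6"
    and cap: "measure_pmf.prob (random_subset n p) {S. s < card S} \<le> 1 / 6"
  shows "admits_sample_based_tester n s \<epsilon> P"
proof -
  define deg where "deg i v = measure_pmf.prob (M i) {g. v \<in> footprint n g}" for i v
  define K where "K i j = {v. v < n \<and> D (Suc j) < deg i v}" for i j
  define L where "L i j = {v. v < n \<and> D j < deg i v \<and> deg i v \<le> D (Suc j)}" for i j
  define X where "X i j z S = layer_estimate (M i) (K i j) (L i j) p z S" for i j z S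
  define W where "W i j = PiE (K i j) (\<lambda>_. UNIV :: 'a set)" for i j
  \<comment> \<open>The threshold \<open>4 * \<delta>\<close> lies between the mean of a correct
    guess, at least \<open>5 * \<delta>\<close>, and that of any guess on a far word, at most
    \<open>\<delta>\<close>. Samples above the cap are rejected.\<close>
  define rule where "rule S v \<longleftrightarrow> card S \<le> s \<and>
      (\<exists>i\<in>I. \<exists>j\<le>q. \<exists>\<kappa>\<in>W i j. 4 * \<delta> \<le> X i j (fill n (K i j) \<kappa> v) S)" for S v
  let ?R = "random_subset n p"
  let ?A = "sample_based n p s (\<lambda>S v. return_pmf (rule S v))"
  have finK: "finite (K i j)" for i j by (simp add: K_def)
  have K_card: "real (card (K i j)) * D (Suc j) \<le> A" if "i \<in> I" for i j
    unfolding K_def deg_def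
  proof (rule card_heavy[OF fin[OF that]])
    fix g assume g: "g \<in> set_pmf (M i)"
    have "footprint n g \<subseteq> {..<n}" using footprint_subset loc[OF that g] by blast
    then show "finite (footprint n g) \<and> real (card (footprint n g)) \<le> A"
      using A[OF that g] finite_subset by blast
  qed
  have petals: "petals (M i) (\<lambda>g. of_bool (snd (g z) \<and> fst (g z) \<inter> L i j = {}))
      (\<lambda>g. if fst (g z) \<inter> L i j = {} then fst (g z) - K i j else {}) n q (D j) p"
    if "i \<in> I" "z \<in> words n" for i j z
    by (rule petals_layer[OF fin[OF that(1)] loc[OF that(1)] that(2)])
      (use p less_imp_le[OF D(1)] in \<open>auto simp: K_def L_def deg_def not_less\<close>)
  have rule_view: "rule S (view x (capped s S)) \<longleftrightarrow> card S \<le> s \<and> (\<exists>i\<in>I. \<exists>j\<le>q. \<exists>\<kappa>\<in>W i j.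
        4 * \<delta> \<le> X i j (fill n (K i j) \<kappa> (\<lambda>i. Some (x ! i))) S)" for S x
  proof (cases "card S \<le> s")
    case True
    then have "capped s S = S" by (simp add: capped_def)
    moreover have "X i j (fill n (K i j) \<kappa> (view x S)) S = X i j (fill n (K i j) \<kappa> (\<lambda>i. Some (x ! i))) S"
      if "i \<in> I" for i j \<kappa>
      unfolding X_def by (rule layer_estimate_fill_view[OF loc[OF that]])
    ultimately show ?thesis unfolding rule_def by simp
  qed (simp add: rule_def)
  have A_map: "?A x = map_pmf (\<lambda>S. rule S (view x (capped s S))) ?R" for x
    by (simp add: sample_based_def map_pmf_def)
  have accept: "pmf (?A x) True = measure_pmf.prob ?R {S. rule S (view x (capped s S))}" for x
    unfolding A_map pmf_map by (rule arg_cong[where f = "measure_pmf.prob ?R"]) auto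
  have reject: "pmf (?A x) False = 1 - pmf (?A x) True" for x
    using pmf_False_conv_True by blast
  have "is_tester n \<epsilon> P ?A"
    unfolding is_tester_def
  proof (intro conjI ballI impI)
    fix x assume x: "x \<in> P"
    then have xw: "x \<in> words n" using P by auto
    obtain i where i: "i \<in> I" "measure_pmf.prob (M i) {g. \<not> snd (g x)} \<le> \<delta>"
      using complete[OF x] by blast
    have "\<exists>j\<le>q. fst (g x) \<inter> L i j = {}" if "g \<in> set_pmf (M i)" for g
    proof (rule exists_missed_set)
      show "card (fst (g x)) \<le> q" "finite (fst (g x))"
        using local_test_queries[OF loc[OF i(1) that] xw] by auto
      \<comment> \<open>Layers are half-open intervals of degrees between consecutive thresholds, so
        monotonicity of \<open>D\<close> makes them disjoint.\<close>
      have lt: "L i a \<inter> L i b = {}" if "a < b" for a b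
      proof -
        have "D (Suc a) \<le> D b" using that by (intro monoD[OF D(2)]) simp
        then show ?thesis unfolding L_def by force
      qed
      fix a b :: nat assume "a \<noteq> b"
      then show "L i a \<inter> L i b = {}" using lt[of a b] lt[of b a] by (cases "a < b") auto
    qed
    then have "\<exists>j\<le>q. 1 \<le> (real q + 1) * measure_pmf.prob (M i) {g. fst (g x) \<inter> L i j = {}}"
      by (rule exists_probable_index)
    then obtain j where j: "j \<le> q"
      "1 \<le> (real q + 1) * measure_pmf.prob (M i) {g. fst (g x) \<inter> L i j = {}}" by blast
    let ?a = "\<lambda>g. of_bool (snd (g x) \<and> fst (g x) \<inter> L i j = {}) :: real"
    let ?B = "\<lambda>g. if fst (g x) \<inter> L i j = {} then fst (g x) - K i j else {}"
    let ?mu = "measure_pmf.expectation (M i) ?a"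
    interpret petals: petals "M i" ?a ?B n q "D j" p
      by (rule petals[OF i(1) xw])
    \<comment> \<open>Some layer is missed with probability at least
      \<open>1 / (q + 1) \<ge> 6 * \<delta>\<close>. Rejecting runs take away at most
      \<open>\<delta>\<close>, which leaves \<open>5 * \<delta>\<close>: a deviation below
      \<open>\<delta>\<close> still passes the threshold.\<close>
    have "measure_pmf.prob (M i) {g. fst (g x) \<inter> L i j = {}}
        \<le> measure_pmf.prob (M i) ({g. snd (g x) \<and> fst (g x) \<inter> L i j = {}} \<union> {g. \<not> snd (g x)})"
      by (intro prob_mono) auto
    also have "\<dots> \<le> measure_pmf.prob (M i) {g. snd (g x) \<and> fst (g x) \<inter> L i j = {}}
        + measure_pmf.prob (M i) {g. \<not> snd (g x)}"
      by (rule measure_Un_le) auto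
    also have "\<dots> \<le> ?mu + \<delta>"
      unfolding expectation_of_bool by (rule add_left_mono[OF i(2)])
    finally have up: "(real q + 1) * measure_pmf.prob (M i) {g. fst (g x) \<inter> L i j = {}} \<le> (real q + 1) * (?mu + \<delta>)"
      by (rule mult_left_mono) simp
    have "(real q + 1) * (6 * \<delta>) = 6 * \<delta> * (real q + 1)" by simp
    also note \<delta>(2)
    also note j(2)
    also note up
    finally have "(real q + 1) * (6 * \<delta>) \<le> (real q + 1) * (?mu + \<delta>)" .
    then have "6 * \<delta> \<le> ?mu + \<delta>" by (rule mult_left_le_imp_le) simp
    then have mu: "5 * \<delta> \<le> ?mu" by linarith
    \<comment> \<open>The correct guess: the symbols of \<open>x\<close> on the kernel, so that
      filling in the rest gives \<open>x\<close> back. \<open>restrict\<close> makes it a member of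
      the finite set \<open>W i j\<close>.\<close>
    define \<kappa> where "\<kappa> = restrict (\<lambda>i. x ! i) (K i j)"
    have \<kappa>: "\<kappa> \<in> W i j" by (auto simp: W_def \<kappa>_def)
    have fillx: "fill n (K i j) \<kappa> (\<lambda>i. Some (x ! i)) = x"
      using xw by (auto simp: fill_def \<kappa>_def words_def intro!: nth_equalityI)
    have "measure_pmf.prob ?R {S. \<not> rule S (view x (capped s S))}
        \<le> measure_pmf.prob ?R ({S. s < card S} \<union> {S. \<delta> \<le> \<bar>petal_estimator (M i) ?a ?B p S - ?mu\<bar>})"
    proof (intro prob_mono)
      fix S assume "S \<in> {S. \<not> rule S (view x (capped s S))}"
      then have "\<not> (card S \<le> s \<and> 4 * \<delta> \<le> X i j x S)"
        using i(1) j(1) \<kappa> fillx unfolding rule_view by force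
      then show "S \<in> {S. s < card S} \<union> {S. \<delta> \<le> \<bar>petal_estimator (M i) ?a ?B p S - ?mu\<bar>}"
        using mu unfolding X_def layer_estimate_def Un_iff mem_Collect_eq by linarith
    qed
    also have "\<dots> \<le> 1 / 6 + q * D j / p ^ q / \<delta>\<^sup>2"
      using cap petals.deviation[OF \<delta>(1)] by (intro order_trans[OF measure_Un_le] add_mono) auto
    also have "\<dots> \<le> 1 / 3" using var[OF j(1)] by linarith
    finally show "2 / 3 \<le> pmf (?A x) True"
      unfolding accept using measure_pmf.prob_compl[of "{S. rule S (view x (capped s S))}" ?R]
      by (simp add: Compl_eq_Diff_UNIV[symmetric] Collect_neg_eq)
  next
    fix x assume xw: "x \<in> words n" and far: "far \<epsilon> P x"
    let ?Z = "\<lambda>i j \<kappa>. fill n (K i j) \<kappa> (\<lambda>i. Some (x ! i))"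
    have each: "measure_pmf.prob ?R {S. 4 * \<delta> \<le> X i j (?Z i j \<kappa>) S} \<le> (1 / 2) ^ k j"
      if i: "i \<in> I" and j: "j \<le> q" for i j \<kappa>
    proof -
      let ?a = "\<lambda>g. of_bool (snd (g (?Z i j \<kappa>)) \<and> fst (g (?Z i j \<kappa>)) \<inter> L i j = {}) :: real"
      let ?B = "\<lambda>g. if fst (g (?Z i j \<kappa>)) \<inter> L i j = {} then fst (g (?Z i j \<kappa>)) - K i j else {}"
      interpret petals: petals "M i" ?a ?B n q "D j" p
        by (rule petals[OF i fill_words])
      have "card (K i j) * D (Suc j) \<le> (\<epsilon> / 2 * n) * D (Suc j)"
        using K_card[OF i] kernel[OF j] by (rule order_trans)
      then have small: "real (card (K i j)) \<le> \<epsilon> / 2 * n" using D(1)[of "Suc j"] by simp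
      \<comment> \<open>A wrong guess changes \<open>x\<close> only on the small kernel, so half of
        the distance survives and soundness of the tests applies.\<close>
      have "far (\<epsilon> - \<epsilon> / 2) P (?Z i j \<kappa>)"
        by (rule far_perturb[OF xw fill_words n far _ finK small]) (auto simp: fill_def)
      then have "measure_pmf.prob (M i) {g. snd (g (?Z i j \<kappa>))} \<le> \<delta>"
        using sound i by (simp add: fill_words)
      moreover have "measure_pmf.expectation (M i) ?a \<le> measure_pmf.prob (M i) {g. snd (g (?Z i j \<kappa>))}"
        unfolding expectation_of_bool by (intro prob_mono) auto
      ultimately have "measure_pmf.expectation (M i) ?a \<le> \<delta>" by linarith
      from petals.upper_tail[OF this \<delta>(1) k[OF j]] show ?thesis
        by (simp only: X_def layer_estimate_def)
    qed
    have finW: "finite (W i j)" for i j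
      unfolding W_def by (intro finite_PiE finK) auto
    \<comment> \<open>Union bound over proofs, layers and kernel assignments; each event concerns a
      word fixed before sampling.\<close>
    have "pmf (?A x) True \<le> measure_pmf.prob ?R
        (\<Union>i\<in>I. \<Union>j\<le>q. \<Union>\<kappa>\<in>W i j. {S. 4 * \<delta> \<le> X i j (?Z i j \<kappa>) S})"
      unfolding accept rule_view by (intro prob_mono) auto
    also have "\<dots> \<le> (\<Sum>i\<in>I. measure_pmf.prob ?R (\<Union>j\<le>q. \<Union>\<kappa>\<in>W i j. {S. 4 * \<delta> \<le> X i j (?Z i j \<kappa>) S}))"
      using I by (intro measure_pmf.finite_measure_subadditive_finite) auto
    also have "\<dots> \<le> (\<Sum>i\<in>I. \<Sum>j\<le>q. measure_pmf.prob ?R (\<Union>\<kappa>\<in>W i j. {S. 4 * \<delta> \<le> X i j (?Z i j \<kappa>) S}))"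
      by (intro sum_mono measure_pmf.finite_measure_subadditive_finite) auto
    also have "\<dots> \<le> (\<Sum>i\<in>I. \<Sum>j\<le>q. \<Sum>\<kappa>\<in>W i j. measure_pmf.prob ?R {S. 4 * \<delta> \<le> X i j (?Z i j \<kappa>) S})"
      using finW by (intro sum_mono measure_pmf.finite_measure_subadditive_finite) auto
    also have "\<dots> \<le> (\<Sum>i\<in>I. \<Sum>j\<le>q. \<Sum>\<kappa>\<in>W i j. (1 / 2) ^ k j)"
      using each by (intro sum_mono) auto
    also have "\<dots> \<le> (\<Sum>i\<in>I. \<Sum>j\<le>q. 1 / (3 * (real q + 1) * card I))"
    proof (intro sum_mono)
      fix i j assume i: "i \<in> I" and j: "j \<in> {..q}"
      define c where "c = 3 * (real q + 1) * card I"
      have "card I > 0" using i I card_gt_0_iff by blast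
      then have c: "c > 0" by (simp add: c_def)
      have "c * real CARD('a) ^ card (K i j) \<le> 2 ^ k j"
        using union[OF _ K_card[OF i], of j] j by (simp add: c_def)
      then have "real CARD('a) ^ card (K i j) * (1 / 2) ^ k j \<le> 1 / c"
        using c by (simp add: field_simps)
      then show "(\<Sum>\<kappa>\<in>W i j. (1 / 2) ^ k j) \<le> 1 / (3 * (real q + 1) * card I)"
        by (simp add: W_def card_PiE finK c_def)
    qed
    also have "\<dots> \<le> 1 / 3"
      by (simp add: field_simps)
    finally show "2 / 3 \<le> pmf (?A x) False" unfolding reject by simp
  qed
  then show ?thesis unfolding admits_sample_based_tester_def using p by (intro exI[of _ p]) auto
qed

subsection \<open>Amplification of decision trees\<close>

lemma queries_verdict_cong:
  "(\<And>i. i \<in> set (queries t x) \<Longrightarrow> y ! i = x ! i) \<Longrightarrow> queries t y = queries t x \<and> verdict t y = verdict t x"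
  by (induction t) auto

text \<open>Branches of the tree that are inconsistent with every input in \<open>W\<close> are not counted, since
  \<^const>\<open>query_bounded\<close> says nothing about them.\<close>

lemma card_reachable_queries:
  fixes t :: "'a::finite dtree"
  assumes "\<And>x. x \<in> W \<Longrightarrow> length (queries t x) \<le> q"
  shows "finite (\<Union>x\<in>W. set (queries t x)) \<and> card (\<Union>x\<in>W. set (queries t x)) \<le> q * CARD('a) ^ q"
  using assms
proof (induction t arbitrary: W q)
  case (Verdict b)
  then show ?case by simp
next
  case (Query i k)
  show ?case
  proof (cases "W = {}")
    case False
    then obtain q' where q: "q = Suc q'" using Query.prems by (cases q) auto
    define T where "T a = (\<Union>x\<in>{x \<in> W. x ! i = a}. set (queries (k a) x))" for a
    have T: "finite (T a) \<and> card (T a) \<le> q' * CARD('a) ^ q'" for a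
      unfolding T_def using Query.prems q by (intro Query.IH) auto
    have sub: "(\<Union>x\<in>W. set (queries (Query i k) x)) \<subseteq> insert i (\<Union>a. T a)"
      by (auto simp: T_def)
    have fin: "finite (insert i (\<Union>a. T a))" using T by auto
    have "card (\<Union>x\<in>W. set (queries (Query i k) x)) \<le> card (insert i (\<Union>a. T a))"
      using sub fin by (intro card_mono)
    also have "\<dots> \<le> Suc (card (\<Union>a. T a))" by (rule card_insert_le_m1) auto
    also have "\<dots> \<le> Suc (\<Sum>a\<in>(UNIV::'a set). card (T a))"
      by (intro Suc_le_mono[THEN iffD2] card_UN_le) simp
    also have "\<dots> \<le> Suc (\<Sum>a\<in>(UNIV::'a set). q' * CARD('a) ^ q')"
      using T by (intro Suc_le_mono[THEN iffD2] sum_mono) auto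
    also have "\<dots> \<le> q * CARD('a) ^ q" by (simp add: q)
    finally show ?thesis using sub fin finite_subset by blast
  qed simp
qed

lemma prob_bind_pmf:
  "measure_pmf.prob (bind_pmf M N) A = measure_pmf.expectation M (\<lambda>x. measure_pmf.prob (N x) A)"
proof -
  have "measure_pmf.prob (bind_pmf M N) A = pmf (map_pmf (\<lambda>x. x \<in> A) (bind_pmf M N)) True"
    by (simp add: pmf_map vimage_def)
  also have "\<dots> = measure_pmf.expectation M (\<lambda>x. measure_pmf.prob (N x) A)"
    by (simp add: map_bind_pmf pmf_bind) (simp add: pmf_map vimage_def)
  finally show ?thesis .
qed

text \<open>An exponential-moment bound in inductive form: a run multiplies the expectation of 2 to
  the number of bad runs by at most \<open>1 + 1 / 3\<close>.\<close>

lemma replicate_pmf_tail: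
  assumes "measure_pmf.prob M {t. b t} \<le> 1 / 3"
  shows "measure_pmf.prob (replicate_pmf r M) {ts. h \<le> length (filter b ts)} \<le> (4 / 3) ^ r / 2 ^ h"
proof (induction r arbitrary: h)
  case 0
  show ?case by (cases h) (auto simp: indicator_def)
next
  case (Suc r)
  show ?case
  proof (cases h)
    case 0
    have "(1::real) \<le> (4 / 3) ^ Suc r" by (intro one_le_power) simp
    then show ?thesis using 0 measure_pmf.prob_le_1 order_trans by fastforce
  next
    case (Suc h')
    \<comment> \<open>A good first run leaves \<open>h\<close> bad runs to be found, with bound
      \<open>c\<close>; a bad one leaves \<open>h'\<close>, with bound \<open>2 * c\<close>.\<close>
    define c :: real where "c = (4 / 3) ^ r / 2 ^ h"
    have c: "c \<ge> 0" "2 * c = (4 / 3) ^ r / 2 ^ h'" by (simp_all add: c_def Suc)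
    have "measure_pmf.prob (replicate_pmf (Suc r) M) {ts. h \<le> length (filter b ts)}
      = measure_pmf.expectation M (\<lambda>t. measure_pmf.prob (replicate_pmf r M) {ts. h \<le> length (filter b (t # ts))})"
      by (simp add: prob_bind_pmf map_pmf_def[symmetric] measure_map_pmf vimage_def)
    also have "\<dots> \<le> measure_pmf.expectation M (\<lambda>t. c + c * of_bool (b t))"
    proof (rule integral_mono)
      show "integrable M (\<lambda>t. measure_pmf.prob (replicate_pmf r M) {ts. h \<le> length (filter b (t # ts))})"
        by (rule measure_pmf.integrable_const_bound[where B = 1]) auto
      show "integrable M (\<lambda>t. c + c * of_bool (b t))"
        using c by (intro measure_pmf.integrable_const_bound[where B = "2 * c"]) auto
      fix t
      show "measure_pmf.prob (replicate_pmf r M) {ts. h \<le> length (filter b (t # ts))} \<le> c + c * of_bool (b t)"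
        using Suc.IH[of h] Suc.IH[of h'] c by (auto simp: Suc c_def)
    qed
    also have "\<dots> = c + c * measure_pmf.prob M {t. b t}"
      by (subst Bochner_Integration.integral_add)
        (auto simp: expectation_of_bool intro!: measure_pmf.integrable_const_bound[where B = 1])
    also have "\<dots> \<le> c + c * (1 / 3)" using assms c by (intro add_left_mono mult_left_mono)
    finally show ?thesis by (simp add: c_def)
  qed
qed

text \<open>Ties reject. Restricting to \<open>words n\<close> leaves only finitely many possible
  functions, although infinitely many trees may occur; this gives the finite support needed for the
  moment bounds.\<close>

definition majority_test :: "nat \<Rightarrow> 'a dtree list \<Rightarrow> 'a list \<Rightarrow> nat set \<times> bool" where
  "majority_test n ts = restrict (\<lambda>x. (\<Union>t\<in>set ts. set (queries t x),
     length ts < 2 * length (filter (\<lambda>t. verdict t x) ts))) (words n)"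

lemma card_UN_set_le:
  assumes "\<And>t. t \<in> set ts \<Longrightarrow> card (F t) \<le> c"
  shows "card (\<Union>t\<in>set ts. F t) \<le> length ts * c"
proof -
  have "card (\<Union>t\<in>set ts. F t) \<le> (\<Sum>t\<in>set ts. card (F t))" by (rule card_UN_le) simp
  also have "\<dots> \<le> (\<Sum>t\<in>set ts. c)" using assms by (intro sum_mono)
  also have "\<dots> \<le> length ts * c" by (simp add: card_length)
  finally show ?thesis .
qed

lemma local_test_majority_test:
  fixes ts :: "'a dtree list"
  assumes b: "\<And>t x. t \<in> set ts \<Longrightarrow> x \<in> words n \<Longrightarrow> set (queries t x) \<subseteq> {..<n} \<and> length (queries t x) \<le> q"
  shows "local_test n (length ts * q) (majority_test n ts)"
  unfolding local_test_def
proof (intro ballI conjI impI)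
  fix x :: "'a list" assume x: "x \<in> words n"
  show "fst (majority_test n ts x) \<subseteq> {..<n}" using b x by (auto simp: majority_test_def)
  have "card (set (queries t x)) \<le> q" if "t \<in> set ts" for t
    using b[OF that x] card_length order_trans by blast
  then show "card (fst (majority_test n ts x)) \<le> length ts * q"
    using x by (simp add: majority_test_def card_UN_set_le)
  fix y :: "'a list" assume y: "y \<in> words n" and eq: "\<forall>i\<in>fst (majority_test n ts x). y ! i = x ! i"
  have "queries t y = queries t x \<and> verdict t y = verdict t x" if "t \<in> set ts" for t
    using eq x that by (intro queries_verdict_cong) (auto simp: majority_test_def)
  then show "majority_test n ts y = majority_test n ts x"
    using x y by (simp add: majority_test_def cong: filter_cong)
qed

lemma card_footprint_majority_test:
  fixes ts :: "'a::finite dtree list"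
  assumes b: "\<And>t x. t \<in> set ts \<Longrightarrow> x \<in> words n \<Longrightarrow> length (queries t x) \<le> q"
  shows "card (footprint n (majority_test n ts)) \<le> length ts * (q * CARD('a) ^ q)"
proof -
  have "footprint n (majority_test n ts) = (\<Union>t\<in>set ts. \<Union>x\<in>words n. set (queries t x))"
    by (auto simp: footprint_def majority_test_def)
  moreover have "card (\<Union>x\<in>words n. set (queries t x)) \<le> q * CARD('a) ^ q" if "t \<in> set ts" for t
    using card_reachable_queries[of "words n" t q] b[OF that] by blast
  ultimately show ?thesis by (simp add: card_UN_set_le)
qed

lemma finite_words: "finite (words n :: 'a::finite list set)"
  using finite_lists_length_eq[of "UNIV :: 'a set" n] by (simp add: words_def)

lemma card_words: "card (words n :: 'a::finite list set) = CARD('a) ^ n"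
  using card_lists_length_eq[of "UNIV :: 'a set" n] by (simp add: words_def)

lemma finite_majority_tests:
  fixes T :: "'a::finite dtree list set"
  assumes b: "\<And>ts t x. ts \<in> T \<Longrightarrow> t \<in> set ts \<Longrightarrow> x \<in> words n \<Longrightarrow> set (queries t x) \<subseteq> {..<n}"
  shows "finite (majority_test n ` T)"
proof (rule finite_subset)
  show "majority_test n ` T \<subseteq> PiE (words n) (\<lambda>_. Pow {..<n} \<times> UNIV)"
    using b by (fastforce simp: majority_test_def PiE_iff)
  show "finite (PiE (words n :: 'a list set) (\<lambda>_. Pow {..<n} \<times> (UNIV :: bool set)))"
    by (intro finite_PiE finite_words) auto
qed

text \<open>With \<open>2 * h\<close> runs, an error of either kind requires at least
  \<open>h\<close> wrong runs.\<close>

definition amplified :: "nat \<Rightarrow> nat \<Rightarrow> 'a dtree pmf \<Rightarrow> ('a list \<Rightarrow> nat set \<times> bool) pmf" where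
  "amplified n h M = map_pmf (majority_test n) (replicate_pmf (2 * h) M)"

lemma amplified_tests:
  fixes M :: "'a::finite dtree pmf"
  assumes "query_bounded n q M"
  shows "finite (set_pmf (amplified n h M))"
    and "g \<in> set_pmf (amplified n h M) \<Longrightarrow> local_test n (2 * h * q) g"
    and "g \<in> set_pmf (amplified n h M) \<Longrightarrow> card (footprint n g) \<le> 2 * h * q * CARD('a) ^ q"
proof -
  have b: "length ts = 2 * h \<and> (\<forall>t\<in>set ts. \<forall>x\<in>words n. set (queries t x) \<subseteq> {..<n} \<and> length (queries t x) \<le> q)"
    if "ts \<in> set_pmf (replicate_pmf (2 * h) M)" for ts
    using that assms by (auto simp: set_replicate_pmf query_bounded_def)
  show "finite (set_pmf (amplified n h M))"
    unfolding amplified_def set_map_pmf using b by (intro finite_majority_tests) blast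
  show "local_test n (2 * h * q) g" if "g \<in> set_pmf (amplified n h M)"
    using that b local_test_majority_test[of _ n q] unfolding amplified_def set_map_pmf by fastforce
  show "card (footprint n g) \<le> 2 * h * q * CARD('a) ^ q" if "g \<in> set_pmf (amplified n h M)"
    using that b card_footprint_majority_test[of _ n q] unfolding amplified_def set_map_pmf
    by (fastforce simp: mult.assoc)
qed

section \<open>Error of the majority vote\<close>

lemma pmf_rand_output: "pmf (rand_output M x) c = measure_pmf.prob M {t. verdict t x = c}"
  by (simp add: rand_output_def pmf_map vimage_def)

lemma amplified_error:
  assumes x: "x \<in> words n" and c: "pmf (rand_output M x) c \<ge> 2 / 3"
  shows "measure_pmf.prob (amplified n h M) {g. snd (g x) \<noteq> c} \<le> (8 / 9) ^ h"
proof -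
  let ?b = "\<lambda>t. verdict t x \<noteq> c"
  have "measure_pmf.prob M {t. ?b t} = 1 - measure_pmf.prob M {t. verdict t x = c}"
    using measure_pmf.prob_compl[of "{t. verdict t x = c}" M]
    by (simp only: Collect_neg_eq Compl_eq_Diff_UNIV) simp
  then have "measure_pmf.prob M {t. ?b t} \<le> 1 / 3"
    using c by (simp add: pmf_rand_output)
  note tail = replicate_pmf_tail[OF this]
  have "measure_pmf.prob (amplified n h M) {g. snd (g x) \<noteq> c}
    \<le> measure_pmf.prob (replicate_pmf (2 * h) M) {ts. h \<le> length (filter ?b ts)}"
    unfolding amplified_def measure_map_pmf
  proof (rule prob_mono)
    fix ts assume ts: "ts \<in> set_pmf (replicate_pmf (2 * h) M)" "ts \<in> majority_test n -` {g. snd (g x) \<noteq> c}"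
    have len: "length ts = 2 * h" using ts(1) by (auto simp: set_replicate_pmf)
    have "length (filter (\<lambda>t. verdict t x) ts) + length (filter (\<lambda>t. \<not> verdict t x) ts) = length ts"
      by (rule sum_length_filter_compl)
    moreover have "(length ts < 2 * length (filter (\<lambda>t. verdict t x) ts)) \<noteq> c"
      using ts(2) x by (simp add: majority_test_def)
    ultimately show "ts \<in> {ts. h \<le> length (filter ?b ts)}"
      using len by (cases c) auto
  qed
  also have "\<dots> \<le> (4 / 3) ^ (2 * h) / 2 ^ h" by (rule tail)
  also have "\<dots> = (8 / 9) ^ h" by (simp add: power_mult power_divide[symmetric] power2_eq_square)
  finally show ?thesis .
qed

subsection \<open>Choice of parameters\<close>

text \<open>Accept if the sample is consistent with some word of \<open>P\<close>. Fewer than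
  \<open>2 * e * n\<close> coordinates typically stay unread, too few to hide the distance of a far
  word from a consistent one.\<close>

lemma tester_reading_almost_everything:
  assumes e: "0 < e" "e \<le> 1 / 4" "2 * e \<le> \<epsilon>" and n: "12 / e\<^sup>2 \<le> real n" and P: "P \<subseteq> words n"
  shows "admits_sample_based_tester n (nat \<lfloor>(1 - e) * n\<rfloor>) \<epsilon> P"
proof -
  \<comment> \<open>Midway between \<open>1 - 2 * e\<close> and the cap \<open>1 - e\<close>, so a
    deviation of the sample size below \<open>e / 2 * n\<close> is harmless on both sides;
    \<open>bad\<close> is the event of a larger one.\<close>
  define p where "p = 1 - 3 / 2 * e"
  define s where "s = nat \<lfloor>(1 - e) * n\<rfloor>"
  define rule where "rule S v \<longleftrightarrow> card S \<le> s \<and> (\<exists>y\<in>P. \<forall>i\<in>S. v i = Some (y ! i))" for S and v :: "nat \<Rightarrow> 'a option"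
  define bad where "bad = {S :: nat set. e / (2 * p) * (p * n) \<le> \<bar>real (card S) - p * n\<bar>}"
  let ?R = "random_subset n p"
  let ?A = "sample_based n p s (\<lambda>S v. return_pmf (rule S v))"
  have p: "0 < p" "p \<le> 1" using e by (auto simp: p_def)
  have "0 < 12 / e\<^sup>2" using e by simp
  with n have "0 < real n" by linarith
  then have npos: "0 < n" by simp
  have "measure_pmf.prob ?R bad \<le> 1 / (p * n * (e / (2 * p))\<^sup>2)"
    unfolding bad_def using e p npos by (intro card_random_subset_deviation) auto
  also have "\<dots> = 4 * p / (n * e\<^sup>2)" using p e npos by (simp add: power2_eq_square field_simps)
  also have "\<dots> \<le> 4 / (n * e\<^sup>2)" using p e npos by (intro divide_right_mono) auto
  also have "\<dots> \<le> 1 / 3" using n e npos by (simp add: field_simps)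
  finally have bad: "measure_pmf.prob ?R bad \<le> 1 / 3" .
  have good: "card S \<le> s" "real n - real (card S) < 2 * e * n" if "S \<notin> bad" for S
  proof -
    have "\<bar>real (card S) - p * n\<bar> < e / 2 * n" using that p by (simp add: bad_def)
    then have "real (card S) < p * n + e / 2 * n" "p * n - e / 2 * n < real (card S)" by linarith+
    then have *: "real (card S) < (1 - e) * n" "(1 - 2 * e) * n < real (card S)"
      by (simp_all add: p_def algebra_simps)
    then show "real n - real (card S) < 2 * e * n" by (simp add: algebra_simps)
    have "int (card S) \<le> \<lfloor>(1 - e) * n\<rfloor>" using * by (simp add: le_floor_iff)
    then show "card S \<le> s" by (simp add: s_def)
  qed
  have A_map: "?A x = map_pmf (\<lambda>S. rule S (view x (capped s S))) ?R" for x
    by (simp add: sample_based_def map_pmf_def)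
  have pmf_A: "pmf (?A x) c = measure_pmf.prob ?R {S. rule S (view x (capped s S)) = c}" for x c
    unfolding A_map pmf_map by (rule arg_cong[where f = "measure_pmf.prob ?R"]) auto
  have prob_good: "2 / 3 \<le> measure_pmf.prob ?R T" if "\<And>S. S \<in> set_pmf ?R \<Longrightarrow> S \<notin> bad \<Longrightarrow> S \<in> T" for T
  proof -
    have "2 / 3 \<le> measure_pmf.prob ?R (UNIV - bad)"
      using bad measure_pmf.prob_compl[of bad ?R] by simp
    also have "\<dots> \<le> measure_pmf.prob ?R T" using that by (intro prob_mono) auto
    finally show ?thesis .
  qed
  have "is_tester n \<epsilon> P ?A"
    unfolding is_tester_def pmf_A
  proof (intro conjI ballI impI prob_good)
    fix x S assume "x \<in> P" "S \<notin> bad"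
    then show "S \<in> {S. rule S (view x (capped s S)) = True}"
      using good(1)[of S] by (auto simp: rule_def capped_def view_def)
  next
    fix x S assume x: "x \<in> words n" "far \<epsilon> P x" and S: "S \<in> set_pmf ?R" "S \<notin> bad"
    have "\<not> rule S (view x (capped s S))"
    proof
      assume "rule S (view x (capped s S))"
      then obtain y where y: "y \<in> P" "\<And>i. i \<in> S \<Longrightarrow> x ! i = y ! i"
        unfolding rule_def capped_def view_def by fastforce
      have sub: "S \<subseteq> {..<n}" using set_random_subset S by blast
      have "{i. i < n \<and> x ! i \<noteq> y ! i} \<subseteq> {..<n} - S" using y by auto
      then have "card {i. i < n \<and> x ! i \<noteq> y ! i} \<le> card ({..<n} - S)" by (intro card_mono) auto
      also have "\<dots> = n - card S" using sub by (simp add: card_Diff_subset finite_subset)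
      finally have "real (card {i. i < n \<and> x ! i \<noteq> y ! i}) \<le> real n - real (card S)"
        using card_mono[OF _ sub] by (simp add: of_nat_diff)
      then have "real (card {i. i < n \<and> x ! i \<noteq> y ! i}) < 2 * e * n" using good(2)[OF S(2)] by linarith
      also have "\<dots> \<le> \<epsilon> * n" using e by (intro mult_right_mono) auto
      finally have "rel_hamming x y < \<epsilon>" using x npos by (simp add: rel_hamming_def words_def field_simps)
      then show False using x y by (auto simp: far_def)
    qed
    then show "S \<in> {S. rule S (view x (capped s S)) = False}" by simp
  qed
  then show ?thesis
    unfolding admits_sample_based_tester_def s_def[symmetric] using p by (intro exI[of _ p]) auto
qed

text \<open>The error must be inversely proportional to the query number \<open>2 * h * q\<close> of
  the amplified test, which itself grows with \<open>h\<close>. Logarithmically many rounds suffice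
  because \<open>(8 / 9) ^ h\<close> decays exponentially; this is the source of the
  \<open>ln q\<close> in the exponent.\<close>

lemma amplification_rounds:
  fixes q :: nat
  assumes q: "2 \<le> q"
  defines "h \<equiv> nat \<lceil>60000 * ln (real q)\<rceil>"
  shows "1 \<le> h" "real h \<le> 60002 * ln q" "(8 / 9) ^ h * (6 * (real (2 * h * q) + 1)) \<le> 1"
proof -
  have "ln 2 \<le> ln (real q)" using q by (subst ln_le_cancel_iff) auto
  then have lnq: "2 / 3 \<le> ln (real q)" using ln2_ge_two_thirds by linarith
  have h: "60000 * ln (real q) \<le> h" "h \<le> 60000 * ln (real q) + 1"
    using lnq unfolding h_def by linarith+
  have h4: "40000 \<le> real h" using h lnq by linarith
  then show "1 \<le> h" by simp
  show "real h \<le> 60002 * ln q" using h lnq by linarith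
  have "real q = exp (ln (real q))" using q by simp
  also have "\<dots> \<le> exp (h / 60000)" using h by simp
  finally have qe: "real q \<le> exp (h / 60000)" .
  \<comment> \<open>This needs \<open>h \<ge> 28800\<close>, which the large constant in
    \<open>h\<close> ensures already for \<open>q = 2\<close>.\<close>
  have "18 * real h \<le> (h / 40)\<^sup>2" using h4 by (simp add: power2_eq_square)
  also have "\<dots> \<le> (exp (h / 40))\<^sup>2"
    using exp_ge_add_one_self[of "h / 40"] by (intro power_mono) linarith+
  also have "\<dots> = exp (h / 20)" by (simp flip: exp_of_nat_mult)
  finally have he: "18 * real h \<le> exp (h / 20)" .
  have "1 \<le> real (h * q)" using h4 q by (metis One_nat_def Suc_le_eq \<open>1 \<le> h\<close> mult_pos_pos of_nat_1 of_nat_le_iff order_less_le_trans pos2)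
  then have "6 * (real (2 * h * q) + 1) \<le> 18 * real h * q" by simp
  also have "\<dots> \<le> exp (h / 20) * exp (h / 60000)" using he qe by (intro mult_mono) auto
  also have "\<dots> \<le> exp (h / 9)" by (simp flip: exp_add)
  finally have 1: "6 * (real (2 * h * q) + 1) \<le> exp (h / 9)" .
  have "(8 / 9 :: real) ^ h \<le> exp (- 1 / 9) ^ h"
    using exp_ge_add_one_self[of "- 1 / 9 :: real"] by (intro power_mono) auto
  also have "\<dots> = exp (- h / 9)" by (simp flip: exp_of_nat_mult)
  finally have "(8 / 9) ^ h * (6 * (real (2 * h * q) + 1)) \<le> exp (- h / 9) * exp (h / 9)"
    using 1 by (intro mult_mono) auto
  then show "(8 / 9) ^ h * (6 * (real (2 * h * q) + 1)) \<le> 1" by (simp flip: exp_add)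
qed

section \<open>Exponential bounds for the parameters\<close>

lemma pow_le_exp: "real c ^ k \<le> exp (real c * real k)"
proof -
  have "real c ^ k \<le> exp (real c) ^ k"
    using exp_ge_add_one_self[of "real c"] by (intro power_mono) linarith+
  then show ?thesis by (simp add: exp_of_nat_mult[symmetric] mult.commute)
qed

lemma real_le_exp: "(x::real) \<le> exp x" "x + 1 \<le> exp x"
  using exp_ge_add_one_self[of x] by linarith+

lemma numeral_le_exp: "2 \<le> exp (1::real)" "6 \<le> exp (3::real)" "36 \<le> exp (6::real)" "12 \<le> exp (4::real)"
proof -
  show 2: "2 \<le> exp (1::real)" using real_le_exp(2)[of 1] by simp
  have pw: "2 ^ k \<le> exp (real k)" for k
    using power_mono[OF 2, of k] by (simp flip: exp_of_nat_mult)
  show "6 \<le> exp (3::real)" "36 \<le> exp (6::real)" "12 \<le> exp (4::real)"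
    using pw[of 3] pw[of 6] pw[of 4] by simp_all
qed

text \<open>The left side is the product \<open>G * W\<close> of \<open>tester_from_MAP\<close>,
  which the ratio of consecutive thresholds has to exceed. Each factor is bounded by an exponential,
  and \<open>w\<close> dominates \<open>1\<close>, \<open>Q\<close>, \<open>L\<close> and
  \<open>Q * L\<close> in the total exponent.\<close>

lemma threshold_ratio_bound:
  fixes Q c q :: nat and L w :: real
  assumes Q: "1 \<le> Q" "q \<le> Q" and w: "real Q \<le> w" "real Q * L \<le> w" and L: "0 \<le> L" and c: "1 \<le> c"
  shows "(36 * (real Q + 1) + c * exp L + c) * (6 * (real Q + 1) * Q * (Q * real c ^ q) * (2 * exp L) ^ Q)
    \<le> exp ((17 + 2 * real c) * w)"
proof -
  have Lw: "L \<le> w"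
    using w Q L by (smt (verit) mult_le_cancel_right1 of_nat_1 of_nat_mono)
  have w1: "1 \<le> w" using w Q by linarith
  have "36 * (real Q + 1) \<le> exp 6 * exp (real Q)"
    using numeral_le_exp real_le_exp by (intro mult_mono) auto
  also have "\<dots> \<le> exp (6 + Q + c + L)" using L by (simp flip: exp_add)
  finally have g1: "36 * (real Q + 1) \<le> exp (6 + Q + c + L)" .
  have "real c * 1 \<le> real c * exp L" using L by (intro mult_left_mono) auto
  then have "c * exp L + c \<le> 2 * (real c * exp L)" by simp
  also have "\<dots> \<le> exp 1 * (exp (real c) * exp L)"
    using numeral_le_exp real_le_exp by (intro mult_mono) auto
  also have "\<dots> \<le> exp (6 + Q + c + L)" by (simp flip: exp_add)
  finally have "36 * (real Q + 1) + c * exp L + c \<le> 2 * exp (6 + Q + c + L)" using g1 by simp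
  also have "\<dots> \<le> exp 1 * exp (6 + Q + c + L)" using numeral_le_exp by (intro mult_right_mono) auto
  finally have G: "36 * (real Q + 1) + c * exp L + c \<le> exp (7 + Q + c + L)"
    by (simp add: exp_add[symmetric] add.assoc)
  have "real c ^ q \<le> real c ^ Q" using c Q by (intro power_increasing) auto
  also have "\<dots> \<le> exp (real c * Q)" by (rule pow_le_exp)
  finally have cq: "real c ^ q \<le> exp (real c * Q)" .
  have "(2 * exp L) ^ Q \<le> (exp 1 * exp L) ^ Q"
    using numeral_le_exp by (intro power_mono mult_right_mono) auto
  also have "\<dots> = exp (Q + Q * L)" by (simp add: exp_of_nat_mult[symmetric] exp_add[symmetric] algebra_simps)
  finally have NQ: "(2 * exp L) ^ Q \<le> exp (Q + Q * L)" .
  have "6 * (real Q + 1) * Q * (Q * real c ^ q) * (2 * exp L) ^ Q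
    \<le> exp 3 * exp (real Q) * exp (real Q) * (exp (real Q) * exp (real c * Q)) * exp (Q + Q * L)"
    using numeral_le_exp real_le_exp cq NQ by (intro mult_mono) auto
  then have W: "6 * (real Q + 1) * Q * (Q * real c ^ q) * (2 * exp L) ^ Q \<le> exp (3 + 4 * Q + c * Q + Q * L)"
    by (simp add: exp_add[symmetric] algebra_simps)
  have "(36 * (real Q + 1) + c * exp L + c) * (6 * (real Q + 1) * Q * (Q * real c ^ q) * (2 * exp L) ^ Q)
    \<le> exp (7 + Q + c + L) * exp (3 + 4 * Q + c * Q + Q * L)"
    using G W by (intro mult_mono) auto
  also have "\<dots> = exp (10 + 5 * Q + c + L + c * Q + Q * L)" by (simp flip: exp_add)
  also have "\<dots> \<le> exp ((17 + 2 * real c) * w)"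
  proof -
    have "real c * Q \<le> real c * w" "real c * 1 \<le> real c * w" using w w1 by (auto intro!: mult_left_mono simp del: mult_1_right)
    then show ?thesis using w w1 Lw by (simp add: algebra_simps)
  qed
  finally show ?thesis .
qed

lemma random_subset_cap:
  assumes p: "0 < p" "p \<le> 1" and pn: "6 \<le> p * real n"
  shows "measure_pmf.prob (random_subset n p) {S. nat \<lfloor>2 * (p * n)\<rfloor> < card S} \<le> 1 / 6"
proof -
  have n: "0 < n" using pn by (cases n) auto
  have "measure_pmf.prob (random_subset n p) {S. nat \<lfloor>2 * (p * n)\<rfloor> < card S}
    \<le> measure_pmf.prob (random_subset n p) {S. 1 * (p * n) \<le> \<bar>real (card S) - p * n\<bar>}"
  proof (intro prob_mono)
    fix S assume "S \<in> {S. nat \<lfloor>2 * (p * n)\<rfloor> < card S}"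
    then have "2 * (p * n) < card S" unfolding mem_Collect_eq by linarith
    then show "S \<in> {S. 1 * (p * n) \<le> \<bar>real (card S) - p * n\<bar>}"
      unfolding mem_Collect_eq by linarith
  qed
  also have "\<dots> \<le> 1 / (p * n * 1\<^sup>2)" by (rule card_random_subset_deviation[OF n p]) simp
  also have "\<dots> \<le> 1 / 6" using pn by simp
  finally show ?thesis .
qed

text \<open>Geometric thresholds with ratio \<open>R\<close> are fed into
  \<open>tester_from_local_tests\<close>. The lower bound on \<open>ln n\<close> makes
  \<open>R\<close> exceed the product of the cost \<open>G\<close> of the guesses and the loss
  \<open>W\<close> in the moment bound.\<close>

lemma tester_from_MAP:
  fixes V :: "'a::finite list \<Rightarrow> 'a dtree pmf" and e L :: real and n m q h Q :: nat
  assumes V: "is_MAP n m q (\<epsilon> / 2) P V" and P: "P \<subseteq> words n"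
    and Q: "Q = 2 * h * q" "1 \<le> h" "1 \<le> q"
    and e: "0 < e" "e \<le> 1" "2 * e \<le> \<epsilon>" and L: "e \<le> L" and m: "real m \<le> exp L"
    and h: "(8 / 9) ^ h * (6 * (real Q + 1)) \<le> 1"
    and n: "1 \<le> n" "2 * (20 + 3 * CARD('a) + 1 / e) / e * (real Q)\<^sup>2 * L \<le> ln n"
  shows "admits_sample_based_tester n (nat \<lfloor>n / exp L\<rfloor>) \<epsilon> P"
proof -
  define c where "c = CARD('a)"
  \<comment> \<open>Dominates \<open>Q\<close>, because \<open>e \<le> L\<close>, and
    \<open>Q * L\<close>, because \<open>e \<le> 1\<close>.\<close>
  define w where "w = Q * L / e"
  \<comment> \<open>\<open>R ^ (Q + 2) = n\<close>: room for \<open>Q + 1\<close> layers and one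
    more factor, which absorbs \<open>1 / e\<close> in the bound \<open>1 \<le> y j\<close>.\<close>
  define R where "R = exp (ln (real n) / (Q + 2))"
  define \<delta> where "\<delta> = 1 / (6 * (real Q + 1))"
  define A where "A = Q * real c ^ q"
  define D where "D j = A * R ^ j / (e * n * R)" for j :: nat
  \<comment> \<open>The cap is twice the expected sample size, which makes it
    \<open>n / exp L\<close>.\<close>
  define p where "p = 1 / (2 * exp L)"
  \<comment> \<open>The bound on the kernel size for layer \<open>j\<close>, as
    \<open>D (Suc j) = A / y j\<close>.\<close>
  define y where "y j = e * n / R ^ j" for j :: nat
  \<comment> \<open>Chosen so that \<open>Q * D j / p ^ Q / \<delta> = W / (R * y j)\<close>; hence
    \<open>k j\<close> is the largest moment order that \<open>upper_tail\<close> admits.\<close>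
  define W where "W = 6 * (real Q + 1) * Q * A * (2 * exp L) ^ Q"
  \<comment> \<open>\<open>G * y j\<close> bounds the logarithm of the number of guesses: layers,
    proofs of length \<open>m \<le> exp L\<close>, and kernel symbols.\<close>
  define G where "G = 36 * (real Q + 1) + c * exp L + c"
  define k where "k j = nat \<lfloor>R * y j / W\<rfloor>" for j :: nat
  have c1: "1 \<le> c" by (simp add: c_def Suc_leI)
  have "2 * 1 * 1 \<le> Q" unfolding Q(1) using Q(2,3) by (intro mult_le_mono) auto
  then have Q2: "2 \<le> Q" by simp
  have qQ: "q \<le> Q" using Q by (cases h) auto
  have L0: "0 < L" using e L by linarith
  have wQ: "real Q \<le> w"
  proof -
    have "Q * e \<le> Q * L" using L by (intro mult_left_mono) auto
    then show ?thesis using e by (simp add: w_def field_simps)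
  qed
  have wQL: "real Q * L \<le> w"
  proof -
    have "Q * L * e \<le> Q * L * 1" using e L0 by (intro mult_left_mono) auto
    then show ?thesis using e by (simp add: w_def field_simps)
  qed
  have w1: "1 \<le> w" using wQ Q2 by linarith
  have "1 * L \<le> Q * L" using L0 Q2 by (intro mult_right_mono) auto
  then have Lw: "L \<le> w" using wQL by simp
  have lnR: "(20 + 3 * c + 1 / e) * w \<le> ln n / (Q + 2)"
  proof -
    have "(20 + 3 * c + 1 / e) * w * (Q + 2) \<le> (20 + 3 * c + 1 / e) * w * (2 * Q)"
      using e w1 Q2 by (intro mult_left_mono) auto
    also have "\<dots> = 2 * (20 + 3 * CARD('a) + 1 / e) / e * (real Q)\<^sup>2 * L"
      by (simp add: w_def c_def power2_eq_square)
    also note n(2)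
    finally show ?thesis by (simp add: pos_le_divide_eq)
  qed
  have w_e: "1 / e \<le> 1 / e * w" "0 \<le> 3 * real c * w" "2 * real c * w \<le> 3 * real c * w"
    using w1 e by (auto simp: field_simps)
  have we0: "0 \<le> 1 / e * w" using w1 e by simp
  have R_le: "exp t \<le> R" if "t \<le> 20 * w + 3 * real c * w + 1 / e * w" for t
    unfolding R_def using that lnR by (simp add: distrib_right)
  have GW: "G * W \<le> R"
  proof -
    have "G * W \<le> exp ((17 + 2 * real c) * w)"
      using threshold_ratio_bound[OF _ qQ wQ wQL _ c1] Q2 L0 by (simp add: G_def W_def A_def)
    also have "\<dots> \<le> R" using w_e w1 we0 unfolding distrib_right by (intro R_le) linarith
    finally show ?thesis .
  qed
  have "1 / e \<le> exp (1 / e)" by (rule real_le_exp)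
  also have "\<dots> \<le> R" using w_e w1 by (intro R_le) linarith
  finally have Re: "1 \<le> e * R" using e by (simp add: field_simps)
  have R1: "1 \<le> R" using R_le[of 0] w1 we0 w_e by simp
  have Rn: "R ^ (Q + 2) = n"
  proof -
    have "R ^ (Q + 2) = exp (ln (real n))"
      unfolding R_def by (subst exp_of_nat_mult[symmetric]) (simp add: field_simps)
    then show ?thesis using n by simp
  qed
  have "12 * exp L \<le> exp 4 * exp L" using numeral_le_exp by (intro mult_right_mono) auto
  also have "\<dots> \<le> R" unfolding exp_add[symmetric] using w_e w1 Lw we0 by (intro R_le) linarith
  also have "\<dots> \<le> n" using self_le_power[OF R1, of "Q + 2"] Rn by simp
  finally have nN: "12 * exp L \<le> n" .
  have A: "0 < A" using Q2 c1 by (simp add: A_def)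
  have W: "0 < W" using A Q2 by (simp add: W_def)
  have G: "36 * (real Q + 1) + c * exp L + c \<le> G" "0 < G" by (simp_all add: G_def add_pos_nonneg)
  have y1: "1 \<le> y j" if "j \<le> Q" for j
  proof -
    have "1 * 1 \<le> (e * R) * R" using Re R1 by (intro mult_mono) auto
    then have "R ^ Q \<le> e * R * R * R ^ Q" using R1 by simp
    also have "\<dots> = e * n" using Rn by (simp add: mult_ac)
    finally have "R ^ Q \<le> e * n" .
    moreover have "R ^ j \<le> R ^ Q" using R1 that by (intro power_increasing)
    ultimately show ?thesis using R1 by (simp add: y_def field_simps)
  qed
  have k_ge: "G * y j \<le> R * y j / W" if "j \<le> Q" for j
  proof -
    have "G * W * y j \<le> R * y j" using GW y1[OF that] by (intro mult_right_mono) auto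
    then show ?thesis using W by (simp add: field_simps)
  qed
  have ypos: "0 < y j" for j using e n R1 by (simp add: y_def)
  have DW: "Q * D j / p ^ Q / \<delta> = W / (R * y j)" for j
    using e n R1 by (simp add: D_def p_def \<delta>_def W_def y_def power_divide field_simps)
  have \<delta>: "0 < \<delta>" by (simp add: \<delta>_def)
  have p1: "0 < p" "p \<le> 1"
  proof -
    have "1 \<le> exp L" using L0 by simp
    then have "1 \<le> 2 * exp L" by linarith
    then show "0 < p" "p \<le> 1" unfolding p_def by auto
  qed
  show ?thesis
  proof (rule tester_from_local_tests[where I = "words m" and M = "\<lambda>\<pi>. amplified n h (V \<pi>)"
        and q = Q and A = A and p = p and \<delta> = \<delta> and D = D and k = k])
    note V' = V[unfolded is_MAP_def]
    show "finite (words m :: 'a list set)" by (rule finite_words)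
    have bounded: "query_bounded n q (V \<pi>)" if "\<pi> \<in> words m" for \<pi>
      using V' that by (elim conjE) (rule bspec)
    show "finite (set_pmf (amplified n h (V \<pi>)))" if "\<pi> \<in> words m" for \<pi>
      using amplified_tests(1)[OF bounded[OF that]] .
    show "local_test n Q g" if "\<pi> \<in> words m" "g \<in> set_pmf (amplified n h (V \<pi>))" for \<pi> g
      using amplified_tests(2)[OF bounded[OF that(1)] that(2)] by (simp only: Q(1))
    show "real (card (footprint n g)) \<le> A" if "\<pi> \<in> words m" "g \<in> set_pmf (amplified n h (V \<pi>))" for \<pi> g
      using of_nat_mono[OF amplified_tests(3)[OF bounded[OF that(1)] that(2)], where 'a = real]
      by (simp add: A_def Q(1) c_def)
    have err: "(8 / 9) ^ h \<le> \<delta>" using h by (simp add: \<delta>_def field_simps)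
    show "\<exists>\<pi>\<in>words m. measure_pmf.prob (amplified n h (V \<pi>)) {g. \<not> snd (g x)} \<le> \<delta>" if xP: "x \<in> P" for x
    proof -
      obtain \<pi> where \<pi>: "\<pi> \<in> words m" "pmf (rand_output (V \<pi>) x) True \<ge> 2 / 3"
        using bspec[OF conjunct1[OF conjunct2[OF V']] xP] by blast
      have "x \<in> words n" using P xP by blast
      from amplified_error[OF this \<pi>(2)] err
      have "measure_pmf.prob (amplified n h (V \<pi>)) {g. \<not> snd (g x)} \<le> \<delta>"
        by (auto intro: order_trans)
      with \<pi>(1) show ?thesis by (rule bexI[rotated])
    qed
    show "measure_pmf.prob (amplified n h (V \<pi>)) {g. snd (g x)} \<le> \<delta>"
      if "x \<in> words n" "far (\<epsilon> / 2) P x" "\<pi> \<in> words m" for x \<pi>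
    proof -
      have "pmf (rand_output (V \<pi>) x) False \<ge> 2 / 3"
        using conjunct2[OF conjunct2[OF V']] that by simp
      from amplified_error[OF that(1) this] err show ?thesis by (auto intro: order_trans)
    qed
    show "0 < p" "p \<le> 1" by (fact p1)+
    show "6 * \<delta> * (real Q + 1) \<le> 1" by (simp add: \<delta>_def field_simps)
    show "0 < D j" for j using A R1 e n by (simp add: D_def)
    show "mono D"
    proof (rule monoI)
      fix i j :: nat assume "i \<le> j"
      then have "R ^ i \<le> R ^ j" using R1 by (intro power_increasing)
      then show "D i \<le> D j" unfolding D_def using A R1 e n by (intro divide_right_mono mult_left_mono) auto
    qed
    have DSuc: "D (Suc j) = A / y j" for j using R1 e n by (simp add: D_def y_def)
    show "A \<le> \<epsilon> / 2 * n * D (Suc j)" if "j \<le> Q" for j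
    proof -
      have "e * 1 \<le> (\<epsilon> / 2) * R ^ j" using e R1 by (intro mult_mono) auto
      then have "A * 1 \<le> A * (\<epsilon> / 2 * R ^ j / e)" using A e by (intro mult_left_mono) auto
      also have "\<dots> = \<epsilon> / 2 * n * D (Suc j)" using R1 e n by (simp add: D_def field_simps)
      finally show ?thesis by simp
    qed
    show "real (k j) * Q * D j / p ^ Q \<le> \<delta>" if "j \<le> Q" for j
    proof -
      have "real (k j) \<le> R * y j / W" unfolding k_def using R1 ypos[of j] W by simp
      then have "real (k j) * (W / (R * y j)) \<le> R * y j / W * (W / (R * y j))"
        using R1 ypos[of j] W by (intro mult_right_mono) auto
      also have "\<dots> = 1" using R1 ypos[of j] W by simp
      finally have "real (k j) * Q * D j / p ^ Q / \<delta> \<le> 1" unfolding DW[symmetric] by simp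
      then show ?thesis by (simp only: divide_le_eq_1_pos[OF \<delta>])
    qed
    show "3 * (real Q + 1) * card (words m :: 'a list set) * real CARD('a) ^ b \<le> 2 ^ k j"
      if j: "j \<le> Q" and b: "real b * D (Suc j) \<le> A" for j b
    proof -
      have bj: "real b \<le> y j" using b A ypos[of j] by (simp add: DSuc field_simps)
      have "real (3 * (Q + 1) + c * (m + b)) \<le> 3 * (real Q + 1) + c * exp L + c * y j"
        using mult_left_mono[OF m, of "real c"] mult_left_mono[OF bj, of "real c"]
        by (simp add: distrib_left)
      also have "\<dots> \<le> (3 * (real Q + 1) + c * exp L + c) * y j"
      proof -
        have "(3 * (real Q + 1) + c * exp L) * 1 \<le> (3 * (real Q + 1) + c * exp L) * y j"
          using y1[OF j] by (intro mult_left_mono) auto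
        then show ?thesis by (simp add: algebra_simps)
      qed
      also have "\<dots> \<le> (G - 1) * y j" using G y1[OF j] by (intro mult_right_mono) auto
      \<comment> \<open>The 1 removed from \<open>G\<close> pays for rounding down in
        \<open>k j\<close>; the slack in \<open>36 * (Q + 1)\<close> provides it.\<close>
      also have "\<dots> \<le> G * y j - 1" using y1[OF j] by (simp add: algebra_simps)
      also have "\<dots> \<le> R * y j / W - 1" using k_ge[OF j] by simp
      also have "\<dots> \<le> k j" unfolding k_def by linarith
      finally have kj: "3 * (Q + 1) + c * (m + b) \<le> k j" by (rule of_nat_le_iff[THEN iffD1])
      \<comment> \<open>Turns all factors into powers of 2 by the crude bound
        \<open>x \<le> 2 ^ x\<close>.\<close>
      have "3 * (Q + 1) * c ^ (m + b) \<le> 2 ^ (3 * (Q + 1)) * (2 ^ c) ^ (m + b)"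
        by (intro mult_le_mono power_mono[of c "2 ^ c"] less_imp_le[OF less_exp]) simp
      also have "\<dots> = 2 ^ (3 * (Q + 1) + c * (m + b))" by (simp add: power_add power_mult)
      also have "\<dots> \<le> 2 ^ k j" using kj by (intro power_increasing) auto
      finally have "real (3 * (Q + 1) * c ^ (m + b)) \<le> real (2 ^ k j)" by (rule of_nat_mono)
      then show ?thesis by (simp add: card_words c_def power_add algebra_simps)
    qed
    show "Q * D j / p ^ Q / \<delta>\<^sup>2 \<le> 1 / 6" if j: "j \<le> Q" for j
    proof -
      \<comment> \<open>Compared with the moment condition the variance carries one more factor
        \<open>1 / \<delta> = 6 * (Q + 1)\<close>; the term \<open>36 * (Q + 1)\<close> in
        \<open>G\<close> absorbs it and leaves 1/6.\<close>
      have "1 * G \<le> y j * G" using y1[OF j] G by (intro mult_right_mono) auto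
      then have "G \<le> R * y j / W" using k_ge[OF j] by (simp add: mult_ac)
      then have "G * (W / (R * y j)) \<le> 1" using W R1 ypos[of j] by (simp add: field_simps)
      moreover have "36 * (real Q + 1) * (W / (R * y j)) \<le> G * (W / (R * y j))"
        using W R1 ypos[of j] by (intro mult_right_mono) (auto simp: G_def)
      moreover have "36 * (real Q + 1) * (W / (R * y j)) = 6 * (W / (R * y j) * (6 * (real Q + 1)))" by simp
      moreover have "Q * D j / p ^ Q / \<delta>\<^sup>2 = W / (R * y j) * (6 * (real Q + 1))"
        unfolding DW[symmetric] by (simp add: power2_eq_square \<delta>_def)
      ultimately show ?thesis by linarith
    qed
    show "measure_pmf.prob (random_subset n p) {S. nat \<lfloor>n / exp L\<rfloor> < card S} \<le> 1 / 6"
    proof -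
      have pn: "n / exp L = 2 * (p * n)" by (simp add: p_def)
      have "6 \<le> p * n" using nN by (simp add: p_def pos_le_divide_eq)
      then show ?thesis unfolding pn by (rule random_subset_cap[OF p1])
    qed
    show "P \<subseteq> words n" "0 < n" "0 < \<delta>" using P n \<delta> by simp_all
  qed
qed

theorem theorem7p11:
  fixes \<epsilon>0 :: real
  assumes "\<epsilon>0 > 0"
  shows "\<exists>C::real. C > 0 \<and> (\<exists>n0::nat. \<forall>n\<ge>n0. \<forall>(q::nat) (m::nat) (\<epsilon>::real) (P :: ('a::finite) list set).
    q \<ge> 2 \<longrightarrow> m \<ge> 1 \<longrightarrow> \<epsilon> / 2 \<ge> \<epsilon>0 \<longrightarrow> P \<subseteq> words n \<longrightarrow> admits_MAP n m q (\<epsilon> / 2) P \<longrightarrow>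
    (\<exists>s::nat. real s \<le> real m * real n powr (1 - 1 / (C * (real q)\<^sup>2 * (ln (real q))\<^sup>2)) \<and>
      admits_sample_based_tester n s \<epsilon> P))"
proof -
  define e where "e = min \<epsilon>0 (1 / 4)"
  define K where "K = 2 * (20 + 3 * CARD('a) + 1 / e) / e"
  \<comment> \<open>\<open>120004 = 2 * 60002\<close>: the amplified test makes
    \<open>2 * h * q\<close> queries with \<open>h \<le> 60002 * ln q\<close>, and \<open>K\<close>
    is the constant in the size condition of \<open>tester_from_MAP\<close>.\<close>
  define C where "C = K * 120004\<^sup>2"
  have e: "0 < e" "e \<le> 1 / 4" "e \<le> \<epsilon>0" using assms by (auto simp: e_def)
  have K: "0 < K" using e by (simp add: K_def add_pos_nonneg)
  then have C: "0 < C" by (simp add: C_def)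
  have main: "\<exists>s::nat. real s \<le> real m * real n powr (1 - 1 / (C * (real q)\<^sup>2 * (ln (real q))\<^sup>2)) \<and>
      admits_sample_based_tester n s \<epsilon> P"
    if n: "nat \<lceil>12 / e\<^sup>2\<rceil> \<le> n" and q: "2 \<le> q" and m: "1 \<le> m" and \<epsilon>: "\<epsilon>0 \<le> \<epsilon> / 2" and P: "P \<subseteq> words n"
      and MAP: "admits_MAP n m q (\<epsilon> / 2) P" for n q m :: nat and \<epsilon> :: real and P :: "'a list set"
  proof -
    \<comment> \<open>Chosen so that the power of \<open>n\<close> in the claim is
      \<open>n / exp L\<close>.\<close>
    define L where "L = ln n / (C * (real q)\<^sup>2 * (ln (real q))\<^sup>2)"
    have n': "12 / e\<^sup>2 \<le> n" using n by linarith
    have "0 < 12 / e\<^sup>2" using e by simp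
    with n' have "0 < real n" by linarith
    then have n1: "1 \<le> n" by simp
    have lnq: "0 < ln (real q)" using q by simp
    have powr: "real n powr (1 - 1 / (C * (real q)\<^sup>2 * (ln (real q))\<^sup>2)) = n / exp L"
      using n1 by (simp add: powr_def L_def left_diff_distrib exp_diff)
    have \<epsilon>2: "2 * e \<le> \<epsilon>" using e \<epsilon> by linarith
    show ?thesis
    \<comment> \<open>Either the allowed sample complexity already covers a \<open>1 - e\<close>
      fraction of the input, or \<open>m\<close> and \<open>q\<close> are small compared with
      \<open>n\<close>. The threshold for \<open>n\<close> can therefore depend on \<open>e\<close>
      alone.\<close>
    proof (cases "(1 - e) * n \<le> real m * (n / exp L)")
      case True
      have "real (nat \<lfloor>(1 - e) * n\<rfloor>) \<le> (1 - e) * n" using e by simp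
      with True show ?thesis
        unfolding powr using tester_reading_almost_everything[OF e(1,2) \<epsilon>2 n' P] order_trans by blast
    next
      case False
      then have "real m / exp L * n < (1 - e) * n" by simp
      then have "real m / exp L < 1 - e" using n1 by (simp only: mult_less_cancel_right)
      then have mL: "real m < (1 - e) * exp L" by (simp add: field_simps)
      \<comment> \<open>As \<open>m \<ge> 1\<close>, the bound \<open>1 - e \<le> exp (- e)\<close>
        forces \<open>e \<le> L\<close>, that is,
        \<open>C * q\<^sup>2 * (ln q)\<^sup>2 \<le> ln n / e\<close>.\<close>
      also have "\<dots> \<le> exp (- e) * exp L"
        using exp_ge_add_one_self[of "- e"] by (intro mult_right_mono) auto
      finally have "real m < exp (L - e)" by (simp add: exp_diff exp_minus field_simps)
      then have "1 < exp (L - e)" using m by linarith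
      then have eL: "e \<le> L" by simp
      have "(1 - e) * exp L \<le> 1 * exp L" using e by (intro mult_right_mono) auto
      with mL have mL: "real m \<le> exp L" by linarith
      define h where "h = nat \<lceil>60000 * ln (real q)\<rceil>"
      note h = amplification_rounds[OF q, folded h_def]
      obtain V where V: "is_MAP n m q (\<epsilon> / 2) P V" using MAP by (auto simp: admits_MAP_def)
      have "real (2 * h * q) \<le> 120004 * (q * ln q)" using h(2) q by (simp add: mult_right_mono)
      then have "(real (2 * h * q))\<^sup>2 \<le> (120004 * (q * ln q))\<^sup>2" by (intro power_mono) auto
      then have "K * (real (2 * h * q))\<^sup>2 * L \<le> K * (120004 * (q * ln q))\<^sup>2 * L"
        using K eL e by (intro mult_right_mono mult_left_mono) auto
      also have "\<dots> = C * (real q)\<^sup>2 * (ln (real q))\<^sup>2 * L" by (simp add: C_def power_mult_distrib)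
      also have "\<dots> = ln n" using C q lnq by (simp add: L_def)
      finally have big: "K * (real (2 * h * q))\<^sup>2 * L \<le> ln n" .
      have "admits_sample_based_tester n (nat \<lfloor>n / exp L\<rfloor>) \<epsilon> P"
        using V P refl h(1) _ e(1) _ \<epsilon>2 eL mL h(3) n1 big[unfolded K_def]
        by (rule tester_from_MAP) (use q e in auto)
      moreover have "real (nat \<lfloor>n / exp L\<rfloor>) \<le> m * (n / exp L)"
      proof -
        have "real (nat \<lfloor>n / exp L\<rfloor>) \<le> 1 * (n / exp L)" by simp
        also have "\<dots> \<le> m * (n / exp L)" using m by (intro mult_right_mono) auto
        finally show ?thesis .
      qed
      ultimately show ?thesis unfolding powr by blast
    qed
  qed
  show ?thesis
    by (rule exI[of _ C], rule conjI[OF C], rule exI[of _ "nat \<lceil>12 / e\<^sup>2\<rceil>"], intro allI impI, rule main)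
qed

end
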